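(* Let $0\le\epsilon\le 1/2$. For every string $S$ of length $n$, there exists a data structure of ${\rm O}(n^{2-2\epsilon}\log n)$ bits, in addition to $S$, that answers range mode enumeration queries. A query range $[l,r]$ with $0\le l\le r<n$ is answered in ${\rm O}(n^{\epsilon}|output|)$ time.
   Context: $S=S[0..n-1]$ is a string over an alphabet $\Sigma$. There is a bijection $\Sigma\to\{0,\dots,|\Sigma|-1\}$ computable in constant time. A mode of a non-empty multiset is an element whose multiplicity is at least that of every other element. The range mode enumeration query for $[l,r]$ asks for all distinct characters that are modes of the multiset $\{S[l],\dots,S[r]\}$. $|output|$ is the number of such characters. Space is counted in bits and excludes the input string $S$, which may be accessed during queries. *)

theory Defs
  imports Complex_Main "HOL-Library.Multiset" "HOL-Library.Landau_Symbols"
begin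

definition modes :: "'a multiset \<Rightarrow> 'a set" where
  "modes M = {x \<in> set_mset M. \<forall>y. count M y \<le> count M x}"

definition range_mset :: "'a list \<Rightarrow> nat \<Rightarrow> nat \<Rightarrow> 'a multiset" where
  "range_mset S l r = image_mset (\<lambda>i. S ! i) (mset_set {l..r})"

definition range_modes :: "'a list \<Rightarrow> nat \<Rightarrow> nat \<Rightarrow> 'a set" where
  "range_modes S l r = modes (range_mset S l r)"

text \<open>
  Query algorithms are programs of a word RAM with \<open>w\<close>-bit words, represented as natural
  numbers below \<open>2 ^ w\<close>. A program is a finite object that names finitely many registers; it
  depends neither on the input string nor on \<open>w\<close>. Besides its registers and a zero-initialised
  scratch memory, the machine has two read-only memories: the input string, given as the list
  \<open>T\<close> of its character codes, and the bit string \<open>D\<close>, which is the data structure. Every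
  elementary instruction and every test takes one unit of time.
\<close>

datatype binop = Add | Sub | Mul | Div | Mod | And | Or | Xor | Shl | Shr | Eq | Less

fun binop_val :: "nat \<Rightarrow> binop \<Rightarrow> nat \<Rightarrow> nat \<Rightarrow> nat" where
  "binop_val w Add x y = take_bit w (x + y)"
| "binop_val w Sub x y = take_bit w (x + 2 ^ w - y)"
| "binop_val w Mul x y = take_bit w (x * y)"
| "binop_val w Div x y = x div y"
| "binop_val w Mod x y = x mod y"
| "binop_val w And x y = Bit_Operations.and x y"
| "binop_val w Or x y = Bit_Operations.or x y"
| "binop_val w Xor x y = Bit_Operations.xor x y"
| "binop_val w Shl x y = take_bit w (push_bit y x)"
| "binop_val w Shr x y = drop_bit y x"
| "binop_val w Eq x y = of_bool (x = y)"
| "binop_val w Less x y = of_bool (x < y)"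

text \<open>
  The destination register is always the first argument; the other register arguments are operands.
\<close>

datatype com =
    Skip
  | Const nat nat
  | Op binop nat nat nat
  | Load nat nat      \<comment> \<open>scratch memory, address in the second register\<close>
  | Store nat nat     \<comment> \<open>address in the first register, value in the second\<close>
  | Read_Char nat nat
  | Read_Data nat nat
  | Emit nat
  | Seq com com
  | If nat com com
  | While nat com

record state =
  regs :: "nat \<Rightarrow> nat"
  mem :: "nat \<Rightarrow> nat"
  emitted :: "nat list"

text \<open>
  The \<open>w\<close> bits of \<open>D\<close> from bit position \<open>p\<close> on, least significant bit first, padded with zeros
  beyond the end of \<open>D\<close>. If \<open>D\<close> is stored in \<open>w\<close>-bit cells, this is two cell accesses and a
  constant number of shifts. It allows space to be counted as the exact length of \<open>D\<close>.
\<close>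

definition data_word :: "nat \<Rightarrow> bool list \<Rightarrow> nat \<Rightarrow> nat" where
  "data_word w D p = horner_sum of_bool 2 (take w (drop p D))"

text \<open>
  \<open>exec w T D p s t s'\<close>: started in state \<open>s\<close>, program \<open>p\<close> terminates after \<open>t\<close> time units in
  state \<open>s'\<close>. Reading beyond the end of the input string has no transition.
\<close>

inductive exec :: "nat \<Rightarrow> nat list \<Rightarrow> bool list \<Rightarrow> com \<Rightarrow> state \<Rightarrow> nat \<Rightarrow> state \<Rightarrow> bool"
  for w :: nat and T :: "nat list" and D :: "bool list" where
  Skip: "exec w T D Skip s 1 s"
| Const: "exec w T D (Const i k) s 1 (s\<lparr>regs := (regs s)(i := take_bit w k)\<rparr>)"
| Op: "exec w T D (Op b i j k) s 1
         (s\<lparr>regs := (regs s)(i := binop_val w b (regs s j) (regs s k))\<rparr>)"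
| Load: "exec w T D (Load i j) s 1 (s\<lparr>regs := (regs s)(i := mem s (regs s j))\<rparr>)"
| Store: "exec w T D (Store i j) s 1 (s\<lparr>mem := (mem s)(regs s i := regs s j)\<rparr>)"
| Read_Char: "regs s j < length T \<Longrightarrow>
    exec w T D (Read_Char i j) s 1 (s\<lparr>regs := (regs s)(i := T ! regs s j)\<rparr>)"
| Read_Data: "exec w T D (Read_Data i j) s 1
                (s\<lparr>regs := (regs s)(i := data_word w D (regs s j))\<rparr>)"
| Emit: "exec w T D (Emit i) s 1 (s\<lparr>emitted := emitted s @ [regs s i]\<rparr>)"
| Seq: "exec w T D p s t s' \<Longrightarrow> exec w T D q s' t' s'' \<Longrightarrow>
    exec w T D (Seq p q) s (t + t') s''"
| IfTrue: "regs s i \<noteq> 0 \<Longrightarrow> exec w T D p s t s' \<Longrightarrow> exec w T D (If i p q) s (1 + t) s'"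
| IfFalse: "regs s i = 0 \<Longrightarrow> exec w T D q s t s' \<Longrightarrow> exec w T D (If i p q) s (1 + t) s'"
| WhileTrue: "regs s i \<noteq> 0 \<Longrightarrow> exec w T D p s t s' \<Longrightarrow> exec w T D (While i p) s' t' s'' \<Longrightarrow>
    exec w T D (While i p) s (1 + t + t') s''"
| WhileFalse: "regs s i = 0 \<Longrightarrow> exec w T D (While i p) s 1 s"

inductive_cases exec_SkipE: "exec w T D Skip s t s'"
inductive_cases exec_ConstE: "exec w T D (Const i k) s t s'"
inductive_cases exec_OpE: "exec w T D (Op b i j k) s t s'"
inductive_cases exec_LoadE: "exec w T D (Load i j) s t s'"
inductive_cases exec_StoreE: "exec w T D (Store i j) s t s'"
inductive_cases exec_Read_CharE: "exec w T D (Read_Char i j) s t s'"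
inductive_cases exec_Read_DataE: "exec w T D (Read_Data i j) s t s'"
inductive_cases exec_EmitE: "exec w T D (Emit i) s t s'"
inductive_cases exec_SeqE: "exec w T D (Seq p q) s t s'"
inductive_cases exec_IfE: "exec w T D (If i p q) s t s'"
inductive_cases exec_WhileE: "exec w T D (While i p) s t s'"

lemma exec_deterministic:
  "exec w T D p s t s' \<Longrightarrow> exec w T D p s u s'' \<Longrightarrow> u = t \<and> s'' = s'"
proof (induction arbitrary: u s'' rule: exec.induct)
  case Skip
  then show ?case by (rule exec_SkipE) simp
next
  case Const
  then show ?case by (rule exec_ConstE) simp
next
  case Op
  then show ?case by (rule exec_OpE) simp
next
  case Load
  then show ?case by (rule exec_LoadE) simp
next
  case Store
  then show ?case by (rule exec_StoreE) simp
next
  case Read_Char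
  from Read_Char.prems show ?case by (rule exec_Read_CharE) simp
next
  case Read_Data
  then show ?case by (rule exec_Read_DataE) simp
next
  case Emit
  then show ?case by (rule exec_EmitE) simp
next
  case (Seq p s t s' q t' s2)
  from Seq.prems show ?case by (rule exec_SeqE) (metis Seq.IH)
next
  case (IfTrue s i p t s' q)
  from IfTrue.prems show ?case by (rule exec_IfE) (use IfTrue.hyps in \<open>auto dest: IfTrue.IH\<close>)
next
  case (IfFalse s i q t s' p)
  from IfFalse.prems show ?case by (rule exec_IfE) (use IfFalse.hyps in \<open>auto dest: IfFalse.IH\<close>)
next
  case (WhileTrue s i p t s' t' s2)
  from WhileTrue.prems show ?case by (rule exec_WhileE) (use WhileTrue.hyps in \<open>auto dest: WhileTrue.IH\<close>)
next
  case (WhileFalse s i p)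
  from WhileFalse.prems show ?case by (rule exec_WhileE) (use WhileFalse.hyps in auto)
qed

definition query_state :: "nat \<Rightarrow> nat \<Rightarrow> state" where
  "query_state l r = \<lparr>regs = (\<lambda>_. 0)(0 := l, 1 := r), mem = (\<lambda>_. 0), emitted = []\<rparr>"

text \<open>
  Within \<open>t\<close> time units the query reports the code under \<open>\<phi>\<close> of each mode of the range exactly
  once, in any order.
\<close>

definition answers_query ::
  "com \<Rightarrow> nat \<Rightarrow> ('a \<Rightarrow> nat) \<Rightarrow> 'a list \<Rightarrow> bool list \<Rightarrow> nat \<Rightarrow> nat \<Rightarrow> real \<Rightarrow> bool" where
  "answers_query p w \<phi> S D l r t \<longleftrightarrow>
     (\<exists>u s. exec w (map \<phi> S) D p (query_state l r) u s \<and> real u \<le> t \<and>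
            distinct (emitted s) \<and> set (emitted s) = \<phi> ` range_modes S l r)"

text \<open>
  Words hold at least \<open>c \<cdot> log (max n \<sigma> + 1)\<close> bits for strings of length \<open>n\<close> over an alphabet of
  size \<open>\<sigma>\<close>: for \<open>c \<ge> 1\<close>, positions and character codes fit into a word.
\<close>

definition admissible_word_length :: "nat \<Rightarrow> nat \<Rightarrow> nat \<Rightarrow> nat \<Rightarrow> bool" where
  "admissible_word_length c n \<sigma> w \<longleftrightarrow> real c * log 2 (real (max n \<sigma>) + 1) \<le> real w"

end

theory Submission
  imports Defs
begin

text \<open>
  The string is cut into blocks of length d, about n to the power of epsilon. For every pair
  (i, j) of block indices the data structure stores the maximal frequency f(i, j) of a
  character in the blocks from i up to but excluding j, and the first block g(i, j), at least i,
  in which a character of that frequency has its first occurrence. In addition it stores the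
  positions of the string sorted by character, and the rank of each position. With these,
  one can test in constant time whether the character at position p occurs more than m
  times in [p, e), or in [a, p]: look m places ahead, or back, in the sorted order.

  A query range consists of a run of full blocks and a prefix and a suffix shorter than d.
  The frequency N of its modes is found by starting from f(i, j) and increasing it whenever a
  position of the prefix or the suffix witnesses a larger frequency; this happens at most 2d
  times. A mode that meets neither prefix nor suffix is a mode of the full blocks. These are
  enumerated by scanning block g(i, j), continuing with i = g(i, j) + 1 as long as f(i, j) = N:
  each scan takes O(d) time and reports at least one mode.
\<close>

section \<open>Occurrences of characters\<close>

text \<open>Enumeration without repetition rests on each mode owning exactly one position at which
  its test succeeds: its first occurrence if it meets the prefix or lies in the full blocks only,
  its last occurrence if it meets the suffix but not the prefix. The tests themselves single out
  these positions, so reported characters are never marked.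

  A second obstacle is uniformity. The program is one fixed object that knows neither the word
  length nor the width of a field, and the bit string is chosen before the word length. All
  parameters are therefore stored in the bit string, in a header that can be decoded for every
  sufficiently large word length.

  The pair table has about (n / d)^2 entries of O(log n) bits. The sorted order adds a number of
  entries linear in n; the bound \<epsilon> \<le> 1/2 is what makes this affordable.\<close>

definition occ :: "nat list \<Rightarrow> nat \<Rightarrow> nat \<Rightarrow> nat \<Rightarrow> nat" where
  "occ T c a b = card {x \<in> {a..<b}. T ! x = c}"

definition max_occ :: "nat list \<Rightarrow> nat \<Rightarrow> nat \<Rightarrow> nat" where
  "max_occ T a b = Max (range (\<lambda>c. occ T c a b))"

lemma occ_le: "occ T c a b \<le> b - a"
proof -
  have "occ T c a b \<le> card {a..<b}"
    unfolding occ_def by (rule card_mono) auto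
  then show ?thesis by simp
qed

lemma occ_split: "a \<le> b \<Longrightarrow> b \<le> d \<Longrightarrow> occ T c a d = occ T c a b + occ T c b d"
  unfolding occ_def by (subst card_Un_disjoint[symmetric]) (auto intro!: arg_cong[where f = card])

lemma occ_mono: "a' \<le> a \<Longrightarrow> b \<le> b' \<Longrightarrow> occ T c a b \<le> occ T c a' b'"
  unfolding occ_def by (rule card_mono) auto

lemma occ_eq_0_iff: "occ T c a b = 0 \<longleftrightarrow> (\<forall>x. a \<le> x \<longrightarrow> x < b \<longrightarrow> T ! x \<noteq> c)"
  unfolding occ_def by auto

lemma finite_range_occ: "finite (range (\<lambda>c. occ T c a b))"
  by (rule finite_subset[of _ "{..b - a}"]) (auto simp: occ_le)

lemma occ_le_max_occ: "occ T c a b \<le> max_occ T a b"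
  unfolding max_occ_def by (rule Max_ge[OF finite_range_occ]) simp

lemma max_occ_attained: "\<exists>c. occ T c a b = max_occ T a b"
  using Max_in[OF finite_range_occ[of T a b]] unfolding max_occ_def by auto

lemma max_occ_le: "max_occ T a b \<le> b - a"
  using max_occ_attained[of T a b] occ_le by metis

lemma max_occ_empty: "b \<le> a \<Longrightarrow> max_occ T a b = 0"
  using max_occ_le[of T a b] by simp

lemma max_occ_mono: "a' \<le> a \<Longrightarrow> b \<le> b' \<Longrightarrow> max_occ T a b \<le> max_occ T a' b'"
  using max_occ_attained[of T a b] occ_mono occ_le_max_occ le_trans by metis

lemma max_occ_pos: "a < b \<Longrightarrow> 0 < max_occ T a b"
  using occ_le_max_occ[of T "T ! a" a b] occ_eq_0_iff[of T "T ! a" a b] by fastforce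

text \<open>Moving the left end of a range to a first occurrence keeps the count and brings it into
  the form that the tests can decide: a count that starts at a position of the character
  itself.\<close>

lemma occ_first:
  assumes "0 < occ T c a b"
  obtains x where "a \<le> x" "x < b" "T ! x = c" "occ T c a x = 0"
proof -
  let ?P = "\<lambda>x. a \<le> x \<and> x < b \<and> T ! x = c"
  have ex: "\<exists>x. ?P x" using assms occ_eq_0_iff[of T c a b] by auto
  have "?P (LEAST x. ?P x)" using ex by (rule LeastI_ex)
  moreover have "occ T c a (LEAST x. ?P x) = 0"
    unfolding occ_eq_0_iff
  proof (intro allI impI notI)
    fix x assume x: "a \<le> x" "x < (LEAST x. ?P x)" "T ! x = c"
    then have "\<not> ?P x" by (intro not_less_Least)
    then show False using x calculation by simp
  qed
  ultimately show ?thesis using that by blast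
qed

lemma occ_last:
  assumes "0 < occ T c a b"
  obtains x where "a \<le> x" "x < b" "T ! x = c" "occ T c (Suc x) b = 0"
proof -
  let ?X = "{x. a \<le> x \<and> x < b \<and> T ! x = c}"
  have ne: "?X \<noteq> {}" using assms occ_eq_0_iff[of T c a b] by auto
  have fin: "finite ?X" by simp
  have "Max ?X \<in> ?X" using fin ne by (rule Max_in)
  moreover have "occ T c (Suc (Max ?X)) b = 0"
    unfolding occ_eq_0_iff
  proof (intro allI impI notI)
    fix x assume "Suc (Max ?X) \<le> x" "x < b" "T ! x = c"
    moreover have "a \<le> Max ?X" using \<open>Max ?X \<in> ?X\<close> by simp
    ultimately have "x \<in> ?X" by simp
    from Max_ge[OF fin this] show False using \<open>Suc (Max ?X) \<le> x\<close> by simp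
  qed
  ultimately show ?thesis using that by blast
qed

section \<open>Where each mode is reported\<close>

text \<open>Since no count exceeds \<open>N\<close>, a count of \<open>N\<close> from
  \<open>p\<close> on leaves no occurrence before \<open>p\<close>; so success in the first two
  lists marks a first occurrence, and success in the third a last one. The middle test stops at
  \<open>R\<close>, which leaves modes that meet the suffix to the third list; the third test starts
  at \<open>L\<close>, which leaves modes that meet the prefix to the first list.\<close>

lemma mode_positions:
  fixes T :: "nat list" and l L R e :: nat
  assumes ord: "l \<le> L" "L \<le> R" "R \<le> e" and lt: "l < e"
  defines "N \<equiv> max_occ T l e"
  defines "ps \<equiv> filter (\<lambda>p. N \<le> occ T (T ! p) p e) [l..<L] @
                  filter (\<lambda>p. N \<le> occ T (T ! p) p R) [L..<R] @
                  filter (\<lambda>p. N \<le> occ T (T ! p) L (Suc p)) [R..<e]"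
  shows "distinct (map ((!) T) ps)" and "set (map ((!) T) ps) = {c. occ T c l e = N}"
proof -
  have pos: "0 < N" using max_occ_pos[OF lt] by (simp add: N_def)
  have le: "occ T c l e \<le> N" for c by (simp add: N_def occ_le_max_occ)
  have nz: "occ T (T ! p) a b \<noteq> 0" if "a \<le> p" "p < b" for p a b
    using that by (auto simp: occ_eq_0_iff)
  have one: "occ T (T ! p) l e = N \<and> occ T (T ! p) l p = 0"
    if "l \<le> p" "p < e" "N \<le> occ T (T ! p) p e" for p
    using that le[of "T ! p"] occ_split[of l p e T "T ! p"] by simp
  have two: "occ T (T ! p) l e = N \<and> occ T (T ! p) l p = 0 \<and> occ T (T ! p) R e = 0"
    if "L \<le> p" "p < R" "N \<le> occ T (T ! p) p R" for p
    using that ord le[of "T ! p"] occ_split[of l p e T "T ! p"] occ_split[of p R e T "T ! p"] by simp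
  have three: "occ T (T ! p) l e = N \<and> occ T (T ! p) l L = 0 \<and> occ T (T ! p) (Suc p) e = 0"
    if "R \<le> p" "p < e" "N \<le> occ T (T ! p) L (Suc p)" for p
    using that ord le[of "T ! p"] occ_split[of l L e T "T ! p"] occ_split[of L "Suc p" e T "T ! p"] by simp
  \<comment> \<open>The later of two reported positions of one character is not a first occurrence,
    so it lies in the suffix. Then the earlier one is excluded in the prefix by \<open>three\<close>
    for \<open>p'\<close>, in the full blocks by \<open>two\<close> for \<open>p\<close>, and in the
    suffix by \<open>three\<close> for \<open>p\<close>.\<close>
  have inj: "p = p'" if "p \<in> set ps" "p' \<in> set ps" "T ! p = T ! p'" "p \<le> p'" for p p'
  proof (rule ccontr)
    assume "p \<noteq> p'"
    with that have less: "p < p'" by simp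
    have lp: "l \<le> p" using that(1) ord by (auto simp: ps_def)
    have "occ T (T ! p') l p' \<noteq> 0" using nz[of l p p'] lp less that(3) by simp
    moreover have "occ T (T ! p') l L \<noteq> 0" if "p < L" using nz[of l p L] lp that \<open>T ! p = T ! p'\<close> by simp
    moreover have "occ T (T ! p) R e \<noteq> 0" if "R \<le> p'" "p' < e"
      using nz[of R p' e] that \<open>T ! p = T ! p'\<close> by simp
    moreover have "occ T (T ! p) (Suc p) e \<noteq> 0" if "p' < e"
      using nz[of "Suc p" p' e] that less \<open>T ! p = T ! p'\<close> by simp
    ultimately show False
      using that(1,2) one[of p'] two[of p'] three[of p'] two[of p] three[of p] ord
      unfolding ps_def by auto
  qed
  have "inj_on ((!) T) (set ps)"
    by (rule inj_onI) (metis inj nle_le)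
  moreover have "distinct ps" using ord by (auto simp: ps_def)
  ultimately show "distinct (map ((!) T) ps)" by (simp add: distinct_map)
  show "set (map ((!) T) ps) = {c. occ T c l e = N}"
  proof (intro set_eqI iffI)
    fix c assume "c \<in> set (map ((!) T) ps)"
    then show "c \<in> {c. occ T c l e = N}"
      using one two three ord by (auto simp: ps_def)
  next
    fix c assume "c \<in> {c. occ T c l e = N}"
    then have c: "occ T c l e = N" by simp
    consider "0 < occ T c l L" | "occ T c l L = 0" "0 < occ T c R e"
      | "occ T c l L = 0" "occ T c R e = 0" by auto
    then show "c \<in> set (map ((!) T) ps)"
    proof cases
      case 1
      then obtain x where x: "l \<le> x" "x < L" "T ! x = c" "occ T c l x = 0" by (rule occ_first)
      then have "occ T c x e = N" using c occ_split[of l x e T c] ord by simp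
      then have "x \<in> set ps" using x ord by (auto simp: ps_def)
      then show ?thesis using x by auto
    next
      case 2
      then obtain x where x: "R \<le> x" "x < e" "T ! x = c" "occ T c (Suc x) e = 0" using occ_last by metis
      then have "occ T c L (Suc x) = N"
        using c 2 occ_split[of l L e T c] occ_split[of L "Suc x" e T c] ord by simp
      then have "x \<in> set ps" using x ord by (auto simp: ps_def)
      then show ?thesis using x by auto
    next
      case 3
      then have LR: "occ T c L R = N"
        using c occ_split[of l L e T c] occ_split[of L R e T c] ord by simp
      with pos have "0 < occ T c L R" by simp
      then obtain x where x: "L \<le> x" "x < R" "T ! x = c" "occ T c L x = 0" by (rule occ_first)
      then have "occ T c x R = N" using LR occ_split[of L x R T c] ord by simp
      then have "x \<in> set ps" using x ord by (auto simp: ps_def)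
      then show ?thesis using x by auto
    qed
  qed
qed

section \<open>The order by character and position\<close>

text \<open>\<open>A\<close> is the sorted list of positions and \<open>idx\<close> its inverse, the
  rank. Breaking ties by position makes the occurrences of a character within an interval
  consecutive.\<close>

definition occ_order :: "nat list \<Rightarrow> (nat \<Rightarrow> nat) \<Rightarrow> (nat \<Rightarrow> nat) \<Rightarrow> bool" where
  "occ_order T idx A \<longleftrightarrow>
     (\<forall>p<length T. idx p < length T \<and> A (idx p) = p) \<and>
     (\<forall>q<length T. A q < length T \<and> idx (A q) = q) \<and>
     (\<forall>p<length T. \<forall>p'<length T. idx p \<le> idx p' \<longleftrightarrow> T ! p < T ! p' \<or> T ! p = T ! p' \<and> p \<le> p')"

lemma occ_order_exists: "\<exists>idx A. occ_order T idx A"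
proof -
  let ?n = "length T"
  \<comment> \<open>The key packs character and position into one number; as positions are below
    \<open>?n\<close>, comparing keys is lexicographic comparison.\<close>
  define key where "key p = T ! p * ?n + p" for p
  have key_le: "key p \<le> key p' \<longleftrightarrow> T ! p < T ! p' \<or> T ! p = T ! p' \<and> p \<le> p'"
    if "p < ?n" "p' < ?n" for p p'
  proof -
    have *: "key a < key b" if "T ! a < T ! b" "a < ?n" for a b
    proof -
      have "key a < (T ! a + 1) * ?n" using that by (simp add: key_def)
      also have "\<dots> \<le> T ! b * ?n" using that by (intro mult_right_mono) auto
      also have "\<dots> \<le> key b" by (simp add: key_def)
      finally show ?thesis .
    qed
    show ?thesis
      using *[of p p'] *[of p' p] that by (cases "T ! p" "T ! p'" rule: linorder_cases) (auto simp: key_def)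
  qed
  define xs where "xs = sort_key key [0..<?n]"
  have len: "length xs = ?n" by (simp add: xs_def)
  have set: "set xs = {..<?n}" by (auto simp: xs_def)
  have dist: "distinct xs" by (simp add: xs_def)
  have sorted: "sorted (map key xs)" by (simp add: xs_def)
  have bij: "bij_betw ((!) xs) {..<?n} {..<?n}"
    using bij_betw_nth[OF dist] len set by auto
  define idx where "idx = inv_into {..<?n} ((!) xs)"
  have 1: "idx p < ?n \<and> xs ! idx p = p" if "p < ?n" for p
    using bij_betw_inv_into_right[OF bij] bij_betw_apply[OF bij_betw_inv_into[OF bij]] that
    by (simp add: idx_def)
  have 2: "xs ! q < ?n \<and> idx (xs ! q) = q" if "q < ?n" for q
    using bij_betw_inv_into_left[OF bij] bij_betw_apply[OF bij] that by (simp add: idx_def)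
  have mono: "key (xs ! a) \<le> key (xs ! b)" if "a \<le> b" "b < ?n" for a b
    using sorted_nth_mono[OF sorted that(1)] that len by simp
  have 3: "idx p \<le> idx p' \<longleftrightarrow> key p \<le> key p'" if "p < ?n" "p' < ?n" for p p'
  proof
    show "key p \<le> key p'" if "idx p \<le> idx p'"
      using mono[OF that] 1 \<open>p < ?n\<close> \<open>p' < ?n\<close> by simp
    show "idx p \<le> idx p'" if "key p \<le> key p'"
    proof (rule ccontr)
      assume "\<not> idx p \<le> idx p'"
      then have "key p' \<le> key p" using mono[of "idx p'" "idx p"] 1 \<open>p < ?n\<close> \<open>p' < ?n\<close> by simp
      then have "p = p'" using that key_le[of p p'] key_le[of p' p] \<open>p < ?n\<close> \<open>p' < ?n\<close> by auto
      then show False using \<open>\<not> idx p \<le> idx p'\<close> by simp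
    qed
  qed
  have "occ_order T idx ((!) xs)"
    unfolding occ_order_def using 1 2 3 key_le by simp
  then show ?thesis by blast
qed

context
  fixes T idx A
  assumes order: "occ_order T idx A"
begin

lemma idx_less: "p < length T \<Longrightarrow> idx p < length T"
  and A_idx: "p < length T \<Longrightarrow> A (idx p) = p"
  and A_less: "q < length T \<Longrightarrow> A q < length T"
  and idx_A: "q < length T \<Longrightarrow> idx (A q) = q"
  and idx_le_iff: "p < length T \<Longrightarrow> p' < length T \<Longrightarrow>
    idx p \<le> idx p' \<longleftrightarrow> T ! p < T ! p' \<or> T ! p = T ! p' \<and> p \<le> p'"
  using order unfolding occ_order_def by blast+

text \<open>Whatever is ranked between two occurrences of \<open>c\<close> has character
  \<open>c\<close> and a position between theirs, because the order is lexicographic. Hence the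
  ranks have no gaps.\<close>

lemma idx_image_interval:
  fixes a b c :: nat
  defines "X \<equiv> {x \<in> {a..<b}. T ! x = c}"
  assumes "b \<le> length T" "X \<noteq> {}"
  shows "\<exists>u v. idx ` X = {u..v}"
proof -
  let ?Y = "idx ` X"
  have fin: "finite ?Y" and ne: "?Y \<noteq> {}" using assms by (auto simp: X_def)
  have "?Y = {Min ?Y..Max ?Y}"
  proof (intro equalityI subsetI)
    fix y assume "y \<in> {Min ?Y..Max ?Y}"
    then obtain x' z' where y: "idx x' \<le> y" "y \<le> idx z'" and X: "x' \<in> X" "z' \<in> X"
      using Min_in[OF fin ne] Max_in[OF fin ne] by auto
    have lt: "x' < length T" "z' < length T" using X assms(2) by (auto simp: X_def)
    then have "y < length T" using y idx_less[of z'] by simp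
    then have y': "A y < length T" "idx (A y) = y" using A_less idx_A by auto
    have c: "T ! x' = c" "T ! z' = c" "a \<le> x'" "z' < b" using X by (auto simp: X_def)
    have "T ! x' < T ! A y \<or> T ! x' = T ! A y \<and> x' \<le> A y"
      using idx_le_iff[OF lt(1) y'(1)] y(1) unfolding y'(2) by blast
    moreover have "T ! A y < T ! z' \<or> T ! A y = T ! z' \<and> A y \<le> z'"
      using idx_le_iff[OF y'(1) lt(2)] y(2) unfolding y'(2) by blast
    ultimately have "T ! A y = c" "a \<le> A y" "A y < b" using c by linarith+
    then have "A y \<in> X" unfolding X_def by simp
    from imageI[OF this, of idx] show "y \<in> ?Y" unfolding y'(2) .
  qed (use fin in auto)
  then show ?thesis by blast
qed

lemma card_idx_image: "b \<le> length T \<Longrightarrow> card (idx ` {x \<in> {a..<b}. T ! x = c}) = occ T c a b"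
  unfolding occ_def by (rule card_image) (rule inj_on_inverseI[of _ A], auto simp: A_idx)

lemma in_idx_image_iff:
  assumes "b \<le> length T"
  shows "y \<in> idx ` {x \<in> {a..<b}. T ! x = c} \<longleftrightarrow> y < length T \<and> a \<le> A y \<and> A y < b \<and> T ! A y = c"
proof
  assume "y < length T \<and> a \<le> A y \<and> A y < b \<and> T ! A y = c"
  then have "y = idx (A y)" "A y \<in> {x \<in> {a..<b}. T ! x = c}" using idx_A by auto
  then show "y \<in> idx ` {x \<in> {a..<b}. T ! x = c}" by blast
qed (use assms idx_less A_idx in auto)

text \<open>The occurrences of \<open>T ! p\<close> from \<open>p\<close> on have the ranks
  \<open>idx p\<close>, \<open>idx p + 1\<close> and so on, so more than \<open>m\<close> of them
  lie before \<open>e\<close> exactly if the entry \<open>m\<close> places ahead is one of them.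
  That its position is at least \<open>p\<close> follows from its rank.\<close>

lemma forward_test_iff:
  assumes "p < e" "e \<le> length T"
  shows "idx p + m < length T \<and> A (idx p + m) < e \<and> T ! A (idx p + m) = T ! p \<longleftrightarrow>
    m < occ T (T ! p) p e"
proof -
  let ?X = "{x \<in> {p..<e}. T ! x = T ! p}"
  have pX: "p \<in> ?X" using assms by simp
  have ge: "idx p \<le> y" if "y \<in> idx ` ?X" for y
    using that assms idx_le_iff by auto
  obtain a b where ab: "idx ` ?X = {a..b}" using idx_image_interval[OF assms(2)] pX by blast
  have "idx p \<in> {a..b}" unfolding ab[symmetric] using pX by blast
  then have b: "idx p \<le> b" and "a \<le> idx p" "a \<in> {a..b}" by auto
  then have "a = idx p" using ge[of a] unfolding ab by simp
  with ab have int: "idx ` ?X = {idx p..b}" by simp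
  have "m < occ T (T ! p) p e \<longleftrightarrow> idx p + m \<in> {idx p..b}"
    using card_idx_image[OF assms(2), of p "T ! p"] b unfolding int by auto
  also have "\<dots> \<longleftrightarrow> idx p + m < length T \<and> p \<le> A (idx p + m) \<and> A (idx p + m) < e \<and>
      T ! A (idx p + m) = T ! p"
    using in_idx_image_iff[OF assms(2), of _ p "T ! p"] unfolding int by blast
  also have "\<dots> \<longleftrightarrow> idx p + m < length T \<and> A (idx p + m) < e \<and> T ! A (idx p + m) = T ! p"
    using idx_le_iff[of p "A (idx p + m)"] A_less[of "idx p + m"] idx_A[of "idx p + m"] assms by auto
  finally show ?thesis by blast
qed

text \<open>The mirror image: here the interval of ranks ends at \<open>idx p\<close>. The explicit
  \<open>m \<le> idx p\<close> guards against the truncated difference, which would stop at rank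
  0.\<close>

lemma backward_test_iff:
  assumes "a \<le> p" "p < length T"
  shows "m \<le> idx p \<and> a \<le> A (idx p - m) \<and> T ! A (idx p - m) = T ! p \<longleftrightarrow>
    m < occ T (T ! p) a (Suc p)"
proof -
  let ?X = "{x \<in> {a..<Suc p}. T ! x = T ! p}"
  have le: "Suc p \<le> length T" using assms by simp
  have pX: "p \<in> ?X" using assms by simp
  have ge: "y \<le> idx p" if "y \<in> idx ` ?X" for y
    using that assms idx_le_iff by auto
  obtain b d where bd: "idx ` ?X = {b..d}" using idx_image_interval[OF le] pX by blast
  have "idx p \<in> {b..d}" unfolding bd[symmetric] using pX by blast
  then have b: "b \<le> idx p" and "idx p \<le> d" "d \<in> {b..d}" by auto
  then have "d = idx p" using ge[of d] unfolding bd by simp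
  with bd have int: "idx ` ?X = {b..idx p}" by simp
  have "m < occ T (T ! p) a (Suc p) \<longleftrightarrow> m \<le> idx p \<and> idx p - m \<in> {b..idx p}"
    using card_idx_image[OF le, of a "T ! p"] b unfolding int by auto
  also have "\<dots> \<longleftrightarrow> m \<le> idx p \<and> (idx p - m < length T \<and> a \<le> A (idx p - m) \<and> A (idx p - m) < Suc p \<and>
      T ! A (idx p - m) = T ! p)"
    using in_idx_image_iff[OF le, of _ a "T ! p"] unfolding int by blast
  also have "\<dots> \<longleftrightarrow> m \<le> idx p \<and> a \<le> A (idx p - m) \<and> T ! A (idx p - m) = T ! p"
    using idx_le_iff[of "A (idx p - m)" p] A_less[of "idx p - m"] idx_A[of "idx p - m"]
      idx_less[of p] assms by auto
  finally show ?thesis by blast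
qed

end

section \<open>Bounded execution of programs\<close>

text \<open>Keeping only an upper bound on the time, and a predicate for the final state, lets
  sequential composition be expressed by nesting.\<close>

definition runs ::
  "nat \<Rightarrow> nat list \<Rightarrow> bool list \<Rightarrow> com \<Rightarrow> state \<Rightarrow> nat \<Rightarrow> (state \<Rightarrow> bool) \<Rightarrow> bool" where
  "runs w T D p s b Q \<longleftrightarrow> (\<exists>t s'. exec w T D p s t s' \<and> t \<le> b \<and> Q s')"

lemma runs_mono:
  assumes "runs w T D p s b Q" "b \<le> b'" "\<And>s'. Q s' \<Longrightarrow> Q' s'"
  shows "runs w T D p s b' Q'"
  using assms unfolding runs_def by (meson le_trans)

lemma runs_Seq:
  assumes "runs w T D p s a (\<lambda>s'. runs w T D q s' b Q)"
  shows "runs w T D (Seq p q) s (a + b) Q"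
  using assms unfolding runs_def by (meson Seq add_mono)

lemma runs_If:
  assumes "regs s i \<noteq> 0 \<Longrightarrow> runs w T D p s b Q" "regs s i = 0 \<Longrightarrow> runs w T D q s b Q"
  shows "runs w T D (If i p q) s (1 + b) Q"
  using assms unfolding runs_def by (meson IfTrue IfFalse add_left_mono)

lemma runs_While_step:
  assumes "regs s i \<noteq> 0" "runs w T D p s a (\<lambda>s'. runs w T D (While i p) s' b Q)"
  shows "runs w T D (While i p) s (1 + a + b) Q"
  using assms unfolding runs_def by (meson WhileTrue add_mono add_left_mono)

lemma runs_While_exit: "regs s i = 0 \<Longrightarrow> Q s \<Longrightarrow> runs w T D (While i p) s 1 Q"
  unfolding runs_def using WhileFalse by blast

lemma runs_exec: "exec w T D p s 1 s' \<Longrightarrow> Q s' \<Longrightarrow> runs w T D p s (Suc 0) Q"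
  unfolding runs_def by auto

fun cost :: "com \<Rightarrow> nat" where
  "cost (Seq p q) = cost p + cost q"
| "cost (If i p q) = 1 + max (cost p) (cost q)"
| "cost _ = 1"

text \<open>Loop-free code is verified by evaluating this function with the simplifier. Loops yield
  \<open>False\<close> here and are treated by induction with the two \<open>While\<close> rules
  above.\<close>

fun wp :: "nat \<Rightarrow> nat list \<Rightarrow> bool list \<Rightarrow> com \<Rightarrow> (state \<Rightarrow> bool) \<Rightarrow> state \<Rightarrow> bool" where
  "wp w T D Skip Q s = Q s"
| "wp w T D (Const i k) Q s = Q (s\<lparr>regs := (regs s)(i := take_bit w k)\<rparr>)"
| "wp w T D (Op b i j k) Q s = Q (s\<lparr>regs := (regs s)(i := binop_val w b (regs s j) (regs s k))\<rparr>)"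
| "wp w T D (Load i j) Q s = Q (s\<lparr>regs := (regs s)(i := mem s (regs s j))\<rparr>)"
| "wp w T D (Store i j) Q s = Q (s\<lparr>mem := (mem s)(regs s i := regs s j)\<rparr>)"
| "wp w T D (Read_Char i j) Q s \<longleftrightarrow>
     regs s j < length T \<and> Q (s\<lparr>regs := (regs s)(i := T ! regs s j)\<rparr>)"
| "wp w T D (Read_Data i j) Q s = Q (s\<lparr>regs := (regs s)(i := data_word w D (regs s j))\<rparr>)"
| "wp w T D (Emit i) Q s = Q (s\<lparr>emitted := emitted s @ [regs s i]\<rparr>)"
| "wp w T D (Seq p q) Q s = wp w T D p (wp w T D q Q) s"
| "wp w T D (If i p q) Q s = (if regs s i \<noteq> 0 then wp w T D p Q s else wp w T D q Q s)"
| "wp w T D (While i p) Q s = False"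

lemma wp_runs: "wp w T D p Q s \<Longrightarrow> runs w T D p s (cost p) Q"
proof (induction p arbitrary: Q s)
  case (Seq p q)
  have "runs w T D p s (cost p) (wp w T D q Q)" using Seq by simp
  then have "runs w T D p s (cost p) (\<lambda>s'. runs w T D q s' (cost q) Q)"
    by (rule runs_mono) (auto intro: Seq.IH)
  then show ?case by (simp add: runs_Seq)
next
  case (If i p q)
  have "runs w T D (If i p q) s (1 + max (cost p) (cost q)) Q"
    by (rule runs_If) (use If.prems in \<open>auto intro: runs_mono[OF If.IH(1)] runs_mono[OF If.IH(2)]\<close>)
  then show ?case by simp
qed (auto intro: runs_exec exec.intros)

lemma wp_runs_le: "wp w T D p Q s \<Longrightarrow> cost p \<le> b \<Longrightarrow> runs w T D p s b Q"
  using wp_runs runs_mono by blast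

primrec block :: "com list \<Rightarrow> com" where
  "block [] = Skip"
| "block (c # cs) = Seq c (block cs)"

text \<open>Machine subtraction wraps around modulo 2 ^ w, so its uses come with a proof that the
  subtrahend is not the larger operand.\<close>

lemma take_bit_sub_eq:
  assumes "y \<le> x" "x < 2 ^ w"
  shows "take_bit w (x + 2 ^ w - y) = (x - y :: nat)"
proof -
  have "x + 2 ^ w - y = (x - y) + 2 ^ w" using assms by simp
  then show ?thesis using assms unfolding take_bit_eq_mod by (simp only: mod_add_self2) simp
qed

text \<open>
  Layout of the registers: 0 and 1 hold the query; 2 is the current position, 3 a frequency,
  12 a block index and 4--16 are temporaries. The registers from 17 on are set up once:
  \<^item> 17: the frequency of the modes of the range
  \<^item> 20, 32: the constants 1 and 0
  \<^item> 21, 22, 23: the width k of a field, 2 ^ k, the position of the first table entry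
  \<^item> 24, 25: the block length, the row length of the block table
  \<^item> 31, 26: the length n of the string, 2 * n
  \<^item> 28, 27: the query range as half-open interval
  \<^item> 30, 29, 33: the start and the (exclusive) end of the run of full blocks inside the
    query range, and the index of the first block after it
\<close>

definition get_field :: "nat \<Rightarrow> nat \<Rightarrow> com" where
  "get_field d q = block [Op Mul 10 q 21, Op Add 10 10 23, Read_Data 10 10, Op Mod d 10 22]"

text \<open>
  If the place looked up lies outside the sorted order, the position read there is multiplied
  by 0, so that \<open>Read_Char\<close> never leaves the string.
\<close>

definition forward_test :: "nat \<Rightarrow> com" where
  "forward_test e = block
     [get_field 5 2, Op Add 5 5 3, Op Less 4 5 26,
      get_field 6 5, Op Mul 6 6 4, Op Less 7 6 e, Op Mul 4 4 7,
      Read_Char 8 6, Read_Char 9 2, Op Eq 8 8 9, Op Mul 4 4 8]"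

definition backward_test :: "nat \<Rightarrow> com" where
  "backward_test a = block
     [get_field 5 2, Op Sub 5 5 3, Op Less 4 5 31, Op Eq 4 4 32,
      get_field 6 5, Op Mul 6 6 4, Op Less 7 6 a, Op Eq 7 7 32, Op Mul 4 4 7,
      Read_Char 8 6, Read_Char 9 2, Op Eq 8 8 9, Op Mul 4 4 8]"

text \<open>The update is free of branches: the test leaves 0 or 1 in register 4, which is added to
  the frequency, and its complement is added to the position. A position is left only after its test
  fails, so it may raise the frequency several times.\<close>

definition count_loop :: "com \<Rightarrow> nat \<Rightarrow> com" where
  "count_loop test b = Seq (Op Less 11 2 b)
     (While 11 (Seq test (block
       [Op Add 3 3 4, Op Sub 4 20 4, Op Add 2 2 4, Op Less 11 2 b])))"

definition emit_loop :: "com \<Rightarrow> nat \<Rightarrow> com" where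
  "emit_loop test b = Seq (Op Less 11 2 b)
     (While 11 (Seq test (block
       [If 4 (Emit 9) Skip, Op Add 2 2 20, Op Less 11 2 b])))"

text \<open>The two entries for (i, j) are adjacent: f(i, j) at the even offset computed here, g(i,
  j) right after it. So \<open>span_loop\<close> reaches g by adding 1 to register 13.\<close>

definition get_span :: com where
  "get_span = block
     [Op Mul 13 12 25, Op Add 13 13 33, Op Add 13 13 13, Op Add 13 13 26, get_field 14 13]"

definition span_loop :: com where
  "span_loop = While 15 (Seq
     (block [Op Add 13 13 20, get_field 14 13, Op Mul 2 14 24, Op Add 12 14 20, Op Mul 16 12 24])
     (Seq (emit_loop (forward_test 29) 16)
       (Seq get_span (Op Eq 15 14 17))))"

text \<open>The division drops the unary prefix and its terminator. Register 23 holds k + 1 while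
  \<open>get_field\<close> reads the header fields 1 to 3; only then is it moved past the four
  header fields to the first table entry.\<close>

definition init_header :: com where
  "init_header = block
     [Const 20 1, Const 4 0, Read_Data 4 4, Op Add 5 4 20, Op Xor 5 4 5, Op Add 5 5 20,
      Op Div 4 4 5, Op Shr 22 5 20, Op Mod 21 4 22, Op Add 23 21 20,
      Const 2 1, get_field 24 2, Const 2 2, get_field 25 2, Const 2 3, get_field 31 2,
      Const 2 4, Op Mul 2 2 21, Op Add 23 23 2]"

text \<open>\<open>And\<close> of a register with itself serves as a copy. The start of the query is
  rounded up to a block index, its end down; the two conditionals clip the run, so that a query
  without a full block gets an empty one.\<close>

definition init_range :: com where
  "init_range = Seq (block
     [Op Add 26 31 31, Op And 28 0 0, Op Add 27 1 20, Op Div 33 27 24,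
      Op Add 12 28 24, Op Sub 12 12 20, Op Div 12 12 24,
      Op Mul 2 12 24, Op Less 3 2 27, If 3 (Op And 30 2 2) (Op And 30 27 27),
      Op Mul 2 33 24, Op Less 3 30 2, If 3 (Op And 29 2 2) (Op And 29 30 30)])
     (Seq get_span (Op And 3 14 14))"

text \<open>The tests are strict, so register 3 is lowered to N - 1 before reporting. Over the
  suffix, counting looks back to the start of the query (register 28), reporting only to the start
  of the run (register 30), because modes that meet the prefix have been reported there.\<close>

definition mode_query :: com where
  "mode_query = Seq init_header (Seq init_range (
     Seq (Op And 2 28 28) (Seq (count_loop (forward_test 27) 30) (
     Seq (Op And 2 29 29) (Seq (count_loop (backward_test 28) 27) (
     Seq (block [Op And 17 3 3, Op Sub 3 3 20, Op And 2 28 28]) (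
     Seq (emit_loop (forward_test 27) 30) (
     Seq (Seq get_span (Op Eq 15 14 17)) (Seq span_loop (
     Seq (Op And 2 29 29) (emit_loop (backward_test 30) 27)))))))))))"

text \<open>A count from \<open>p\<close> on that reaches the maximum already makes \<open>p\<close>
  a first occurrence in the range of blocks.\<close>

definition next_block :: "nat list \<Rightarrow> nat \<Rightarrow> nat \<Rightarrow> nat \<Rightarrow> nat" where
  "next_block T d i j = (LEAST g. i \<le> g \<and>
     (\<exists>p \<in> {g * d..<(g + 1) * d}. max_occ T (i * d) (j * d) \<le> occ T (T ! p) p (j * d)))"

section \<open>What the program reads from the bit string\<close>

text \<open>A rank is stored as n + idx p, which is also the address of the field for
  \<open>A (idx p)\<close>. Adding or subtracting a frequency m \<le> n gives directly the address
  to look up, the subtraction cannot wrap, and a place outside the sorted order shows as an address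
  below n or from 2 n on. The 3 n in \<open>fit\<close> covers the largest such address, n + idx p +
  m.\<close>

locale mode_table =
  fixes w :: nat and T :: "nat list" and D :: "bool list"
    and k base d W :: nat and idx A :: "nat \<Rightarrow> nat" and fld :: "nat \<Rightarrow> nat"
  defines "fld \<equiv> \<lambda>q. data_word w D (base + q * k) mod 2 ^ k"
  assumes order: "occ_order T idx A"
    and d_pos: "0 < d"
    and W_def: "W = length T div d + 2"
    and k_pos: "0 < k"
    and fit: "base + (3 * length T + 2 * (W * W)) * k < 2 ^ w"
    and fit_k: "2 ^ k < (2 :: nat) ^ w"
    and small: "length T + d < 2 ^ w"
    and idx_field: "\<And>p. p < length T \<Longrightarrow> fld p = length T + idx p"
    and A_field: "\<And>q. q < length T \<Longrightarrow> fld (length T + q) = A q"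
    and occ_field: "\<And>i j. i \<le> length T div d + 1 \<Longrightarrow> j \<le> length T div d \<Longrightarrow>
      fld (2 * length T + 2 * (i * W + j)) = max_occ T (i * d) (j * d)"
    and next_field: "\<And>i j. i < j \<Longrightarrow> j \<le> length T div d \<Longrightarrow>
      fld (2 * length T + 2 * (i * W + j) + 1) = next_block T d i j"
begin

abbreviation "n \<equiv> length T"

lemma fits: "q \<le> 3 * n + 2 * (W * W) \<Longrightarrow> base + q * k < 2 ^ w"
  using fit mult_right_mono[of q "3 * n + 2 * (W * W)" k] by linarith

lemma fits_mult: "q \<le> 3 * n + 2 * (W * W) \<Longrightarrow> q * k < 2 ^ w"
  using fits[of q] by linarith

lemma fits_self: "q \<le> 3 * n + 2 * (W * W) \<Longrightarrow> q < 2 ^ w"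
  using fits_mult[of q] k_pos mult_le_mono2[of 1 k q] by linarith

definition ready :: "state \<Rightarrow> bool" where
  "ready s \<longleftrightarrow> regs s 20 = 1 \<and> regs s 21 = k \<and> regs s 22 = 2 ^ k \<and> regs s 23 = base \<and>
     regs s 24 = d \<and> regs s 25 = W \<and> regs s 26 = 2 * n \<and> regs s 31 = n \<and> regs s 32 = 0"

lemma wp_get_field:
  assumes "regs s 21 = k" "regs s 22 = 2 ^ k" "regs s 23 = base" "regs s q \<le> 3 * n + 2 * (W * W)"
  shows "wp w T D (get_field d' q) Q s =
    Q (s\<lparr>regs := (regs s)(10 := data_word w D (base + regs s q * k), d' := fld (regs s q))\<rparr>)"
  using assms fits[of "regs s q"] fits_mult[of "regs s q"]
  by (simp add: get_field_def fld_def take_bit_nat_eq_self fun_upd_upd add.commute)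

definition test_frame :: "state \<Rightarrow> state \<Rightarrow> bool" where
  "test_frame s s' \<longleftrightarrow> emitted s' = emitted s \<and> (\<forall>x. x < 4 \<or> 10 < x \<longrightarrow> regs s' x = regs s x)"

text \<open>Allows each loop to be verified once for both tests. The bound 22 is the cost of the
  backward test, the longer of the two.\<close>

definition implements_test :: "com \<Rightarrow> (nat \<Rightarrow> nat \<Rightarrow> bool) \<Rightarrow> state \<Rightarrow> bool" where
  "implements_test test P s \<longleftrightarrow> runs w T D test s 22 (\<lambda>s'. test_frame s s' \<and>
     regs s' 4 = of_bool (P (regs s 2) (regs s 3)) \<and> regs s' 9 = T ! regs s 2)"

lemma forward_test:
  assumes c: "ready s" and b: "10 < b" and p: "regs s 2 < regs s b" "regs s b \<le> n" and m: "regs s 3 \<le> n"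
  shows "implements_test (forward_test b) (\<lambda>p m. m < occ T (T ! p) p (regs s b)) s"
proof -
  define p m where "p = regs s 2" and "m = regs s 3"
  have pn: "p < n" "p < regs s b" using p by (simp_all add: p_def)
  have ix: "idx p < n" using idx_less[OF order pn(1)] .
  have mn: "m \<le> n" using m by (simp add: m_def)
  note eqs = p_def[symmetric] m_def[symmetric]
  have r: "regs s 20 = 1" "regs s 21 = k" "regs s 22 = 2 ^ k" "regs s 23 = base" "regs s 26 = 2 * n"
    "regs s 31 = n" "regs s 32 = 0" using c by (simp_all add: ready_def)
  have w0: "0 < w" using fit_k by (cases w) auto
  then have bit: "take_bit w (of_bool P * of_bool Q) = (of_bool (P \<and> Q) :: nat)" for P Q
    by (auto simp: take_bit_eq_mod)
  define q where "q = n + idx p + m"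
  have q: "q \<le> 3 * n + 2 * (W * W)" "n + idx p + m = q" using ix mn by (simp_all add: q_def)
  have tb: "take_bit w q = q" using fits_self[OF q(1)] by (rule take_bit_nat_eq_self)
  have f1: "fld p = n + idx p" using idx_field pn by simp
  \<comment> \<open>For \<open>q\<close> from 2 n on, the field read is not a position of the order.
    The factor 0 turns it into position 0, which exists because \<open>p < n\<close>, and the flag
    stays 0.\<close>
  have "take_bit w (fld q * of_bool (q < 2 * n)) = (if q < 2 * n then A (idx p + m) else 0)"
    using A_field[of "idx p + m"] A_less[OF order, of "idx p + m"] fits_self[of "A (idx p + m)"]
    by (auto simp: q_def add.assoc intro!: take_bit_nat_eq_self)
  moreover have "q < 2 * n \<Longrightarrow> A (idx p + m) < n"
    using A_less[OF order, of "idx p + m"] by (simp add: q_def)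
  moreover have "(q < 2 * n \<and> A (idx p + m) < regs s b) \<and> T ! A (idx p + m) = T ! p \<longleftrightarrow>
      m < occ T (T ! p) p (regs s b)"
    using forward_test_iff[OF order pn(2) p(2), of m] by (auto simp: q_def)
  ultimately have "wp w T D (forward_test b) (\<lambda>s'. test_frame s s' \<and>
     regs s' 4 = of_bool (m < occ T (T ! p) p (regs s b)) \<and> regs s' 9 = T ! p) s"
    using b pn q(1) w0
    by (cases "q < 2 * n") (auto simp: forward_test_def wp_get_field r eqs f1 q tb bit test_frame_def)
  then show ?thesis
    unfolding implements_test_def eqs
    by (rule wp_runs_le) (simp add: forward_test_def get_field_def)
qed

lemma backward_test:
  assumes c: "ready s" and b: "10 < b" and p: "regs s b \<le> regs s 2" "regs s 2 < n" and m: "regs s 3 \<le> n"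
  shows "implements_test (backward_test b) (\<lambda>p m. m < occ T (T ! p) (regs s b) (Suc p)) s"
proof -
  define p m where "p = regs s 2" and "m = regs s 3"
  have pn: "p < n" "regs s b \<le> p" using p by (simp_all add: p_def)
  have ix: "idx p < n" using idx_less[OF order pn(1)] .
  have mn: "m \<le> n" using m by (simp add: m_def)
  note eqs = p_def[symmetric] m_def[symmetric]
  have r: "regs s 20 = 1" "regs s 21 = k" "regs s 22 = 2 ^ k" "regs s 23 = base" "regs s 26 = 2 * n"
    "regs s 31 = n" "regs s 32 = 0" using c by (simp_all add: ready_def)
  have w0: "0 < w" using fit_k by (cases w) auto
  then have bit: "take_bit w (of_bool P * of_bool Q) = (of_bool (P \<and> Q) :: nat)" for P Q
    by (auto simp: take_bit_eq_mod)
  define q where "q = n + idx p - m"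
  have q: "q \<le> 3 * n + 2 * (W * W)" using ix mn by (simp add: q_def)
  \<comment> \<open>No wrap-around: \<open>m\<close> is at most n, and the stored rank is shifted up
    by n.\<close>
  have tb: "take_bit w (n + idx p + 2 ^ w - m) = q"
    unfolding q_def by (rule take_bit_sub_eq) (use ix mn fits_self[of "n + idx p"] in auto)
  have f1: "fld p = n + idx p" using idx_field pn by simp
  have valid: "n \<le> q \<longleftrightarrow> m \<le> idx p" using ix mn by (auto simp: q_def)
  have a: "m \<le> idx p \<Longrightarrow> fld q = A (idx p - m) \<and> A (idx p - m) < n"
    using A_field[of "idx p - m"] A_less[OF order, of "idx p - m"] ix by (simp add: q_def)
  have occ: "m \<le> idx p \<and> regs s b \<le> A (idx p - m) \<and> T ! A (idx p - m) = T ! p \<longleftrightarrow>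
      m < occ T (T ! p) (regs s b) (Suc p)"
    by (rule backward_test_iff[OF order pn(2,1)])
  have "wp w T D (backward_test b) (\<lambda>s'. test_frame s s' \<and>
     regs s' 4 = of_bool (m < occ T (T ! p) (regs s b) (Suc p)) \<and> regs s' 9 = T ! p) s"
  proof (cases "m \<le> idx p")
    case True
    with a valid have "fld q = A (idx p - m)" "A (idx p - m) < n" "n \<le> q"
        "take_bit w (A (idx p - m)) = A (idx p - m)"
      using fits_self[of "A (idx p - m)"] by (auto intro!: take_bit_nat_eq_self)
    moreover have "regs s b \<le> A (idx p - m) \<and> T ! A (idx p - m) = T ! p \<longleftrightarrow>
      m < occ T (T ! p) (regs s b) (Suc p)" using occ True by simp
    ultimately show ?thesis
      using b pn q w0
      by (auto simp: backward_test_def wp_get_field r eqs f1 tb bit test_frame_def not_less)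
  next
    case False
    with valid have "q < n" by simp
    moreover have "\<not> m < occ T (T ! p) (regs s b) (Suc p)" using occ False by simp
    ultimately show ?thesis
      using b pn q w0
      by (auto simp: backward_test_def wp_get_field r eqs f1 tb bit test_frame_def not_less)
  qed
  then show ?thesis
    unfolding implements_test_def eqs
    by (rule wp_runs_le) (simp add: backward_test_def get_field_def)
qed

section \<open>The counting loop and the reporting loop\<close>

definition same :: "nat set \<Rightarrow> state \<Rightarrow> state \<Rightarrow> bool" where
  "same X s s' \<longleftrightarrow> (\<forall>x\<in>X. regs s' x = regs s x)"

lemma same_refl: "same X s s"
  by (simp add: same_def)

lemma ready_same: "ready s \<Longrightarrow> same X s s' \<Longrightarrow> {17..} \<subseteq> X \<Longrightarrow> ready s'"
  unfolding ready_def same_def by (simp add: subset_iff)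

text \<open>Every round raises the frequency, bounded by \<open>U\<close>, or moves the position,
  bounded by register \<open>b\<close>. The sum of both distances is thus the measure of the
  induction and the number of rounds; 28 = 1 + 22 + 5 pays for guard, test and update.\<close>

lemma count_while:
  assumes b: "11 < b" and E: "regs u b \<le> n" and one: "regs u 20 = 1"
    and test: "\<And>s. same {12..} u s \<Longrightarrow> regs s 2 < regs u b \<Longrightarrow> Inv (regs s 2) (regs s 3) \<Longrightarrow>
      implements_test test P s"
    and up: "\<And>p F. Inv p F \<Longrightarrow> p < regs u b \<Longrightarrow> P p F \<Longrightarrow> Inv p (F + 1)"
    and stay: "\<And>p F. Inv p F \<Longrightarrow> p < regs u b \<Longrightarrow> \<not> P p F \<Longrightarrow> Inv (p + 1) F"
    and U: "\<And>p F. Inv p F \<Longrightarrow> F \<le> U" "U \<le> n"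
  shows "same {12..} u s \<Longrightarrow> Inv (regs s 2) (regs s 3) \<Longrightarrow> regs s 2 \<le> regs u b \<Longrightarrow>
    regs s 11 = of_bool (regs s 2 < regs u b) \<Longrightarrow>
    runs w T D (While 11 (Seq test (block [Op Add 3 3 4, Op Sub 4 20 4, Op Add 2 2 4, Op Less 11 2 b])))
      s (1 + 28 * ((regs u b - regs s 2) + (U - regs s 3)))
      (\<lambda>s'. emitted s' = emitted s \<and> same {12..} u s' \<and> Inv (regs u b) (regs s' 3))"
proof (induction "(regs u b - regs s 2) + (U - regs s 3)" arbitrary: s rule: less_induct)
  case less
  let ?body = "block [Op Add 3 3 4, Op Sub 4 20 4, Op Add 2 2 4, Op Less 11 2 b]"
  let ?Q = "\<lambda>s'. emitted s' = emitted s \<and> same {12..} u s' \<and> Inv (regs u b) (regs s' 3)"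
  show ?case
  proof (cases "regs s 2 < regs u b")
    case False
    then have "runs w T D (While 11 (Seq test ?body)) s 1 ?Q"
      using less.prems by (intro runs_While_exit) auto
    then show ?thesis by (rule runs_mono) auto
  next
    case True
    define p F c where "p = regs s 2" and "F = regs s 3" and "c = P p F"
    have inv: "Inv p F" and p: "p < regs u b" using less.prems True by (simp_all add: p_def F_def)
    have Fn: "F \<le> U" using U(1)[OF inv] .
    define p' F' where "p' = p + of_bool (\<not> c)" and "F' = F + of_bool c"
    have inv': "Inv p' F'"
      using up[OF inv p] stay[OF inv p] by (cases c) (auto simp: p'_def F'_def c_def)
    then have F'n: "F' \<le> U" using U(1) by blast
    have bnd: "p' < 2 ^ w" "F' < 2 ^ w" "1 < (2::nat) ^ w"
      using fits_self[of p'] fits_self[of F'] fits_self[of 1] p E F'n U(2)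
      by (auto simp: p'_def)
    have sub: "take_bit w (Suc (2 ^ w) - of_bool c) = 1 - of_bool c"
      using take_bit_sub_eq[of "of_bool c" 1 w] bnd by simp
    have "runs w T D test s 22 (\<lambda>s'. test_frame s s' \<and> regs s' 4 = of_bool c \<and> regs s' 9 = T ! p)"
      using test[OF less.prems(1) True less.prems(2)] by (simp add: implements_test_def p_def F_def c_def)
    moreover have "runs w T D ?body s' 5 (\<lambda>s''. emitted s'' = emitted s \<and> same {12..} u s'' \<and>
        regs s'' 2 = p' \<and> regs s'' 3 = F' \<and> regs s'' 11 = of_bool (p' < regs u b))"
      if "test_frame s s' \<and> regs s' 4 = of_bool c \<and> regs s' 9 = T ! p" for s'
    proof (rule wp_runs_le)
      have "regs s' 2 = p" "regs s' 3 = F" "regs s' b = regs u b" "regs s' 20 = 1"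
        "\<And>x. 11 < x \<Longrightarrow> regs s' x = regs u x" "emitted s' = emitted s" "regs s' 4 = of_bool c"
        using that less.prems(1) b one by (auto simp: test_frame_def same_def p_def F_def)
      then show "wp w T D ?body (\<lambda>s''. emitted s'' = emitted s \<and> same {12..} u s'' \<and>
        regs s'' 2 = p' \<and> regs s'' 3 = F' \<and> regs s'' 11 = of_bool (p' < regs u b)) s'"
        using b bnd sub
        by (cases c) (simp_all add: take_bit_nat_eq_self p'_def F'_def same_def)
    qed simp
    ultimately have body: "runs w T D (Seq test ?body) s (22 + 5) (\<lambda>s''. emitted s'' = emitted s \<and>
        same {12..} u s'' \<and> regs s'' 2 = p' \<and> regs s'' 3 = F' \<and> regs s'' 11 = of_bool (p' < regs u b))"
      by (intro runs_Seq) (auto elim: runs_mono)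
    have measure: "Suc ((regs u b - p') + (U - F')) = (regs u b - p) + (U - F)"
      using p Fn F'n by (auto simp: p'_def F'_def)
    let ?B = "1 + 28 * ((regs u b - p') + (U - F'))"
    have "runs w T D (While 11 (Seq test ?body)) s'' ?B ?Q"
      if s'': "emitted s'' = emitted s \<and> same {12..} u s'' \<and> regs s'' 2 = p' \<and> regs s'' 3 = F' \<and>
        regs s'' 11 = of_bool (p' < regs u b)" for s''
    proof -
      have "p' \<le> regs u b" using p by (auto simp: p'_def)
      then show ?thesis
        using less.hyps[of s''] s'' inv' measure by (simp add: p_def F_def)
    qed
    then have "runs w T D (Seq test ?body) s 27 (\<lambda>s''. runs w T D (While 11 (Seq test ?body)) s'' ?B ?Q)"
      using body by (auto elim: runs_mono)
    then have "runs w T D (While 11 (Seq test ?body)) s (1 + 27 + ?B) ?Q"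
      using less.prems(4) True by (intro runs_While_step) auto
    then show ?thesis
      by (rule runs_mono) (use measure in \<open>auto simp: p_def F_def\<close>)
  qed
qed

lemma count_loop:
  assumes b: "11 < b" and E: "regs s b \<le> n" and one: "regs s 20 = 1"
    and test: "\<And>s'. same {12..} s s' \<Longrightarrow> regs s' 2 < regs s b \<Longrightarrow> Inv (regs s' 2) (regs s' 3) \<Longrightarrow>
      implements_test test P s'"
    and up: "\<And>p F. Inv p F \<Longrightarrow> p < regs s b \<Longrightarrow> P p F \<Longrightarrow> Inv p (F + 1)"
    and stay: "\<And>p F. Inv p F \<Longrightarrow> p < regs s b \<Longrightarrow> \<not> P p F \<Longrightarrow> Inv (p + 1) F"
    and U: "\<And>p F. Inv p F \<Longrightarrow> F \<le> U" "U \<le> n"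
    and init: "Inv (regs s 2) (regs s 3)" "regs s 2 \<le> regs s b"
  shows "runs w T D (count_loop test b) s (2 + 28 * ((regs s b - regs s 2) + (U - regs s 3)))
      (\<lambda>s'. emitted s' = emitted s \<and> same {12..} s s' \<and> Inv (regs s b) (regs s' 3))"
proof -
  let ?s = "s\<lparr>regs := (regs s)(11 := of_bool (regs s 2 < regs s b))\<rparr>"
  have "same {12..} s ?s" by (simp add: same_def)
  from count_while[where Inv = Inv and P = P and u = s, OF b E one test up stay U this]
  have "runs w T D (Op Less 11 2 b) s 1 (\<lambda>s'. runs w T D
     (While 11 (Seq test (block [Op Add 3 3 4, Op Sub 4 20 4, Op Add 2 2 4, Op Less 11 2 b])))
     s' (1 + 28 * ((regs s b - regs s 2) + (U - regs s 3)))
     (\<lambda>s'. emitted s' = emitted s \<and> same {12..} s s' \<and> Inv (regs s b) (regs s' 3)))"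
    using init by (intro wp_runs_le) simp_all
  from runs_Seq[OF this] show ?thesis
    unfolding count_loop_def by (rule runs_mono) auto
qed

text \<open>The lower bound \<open>a\<close> is carried along because a backward test is meaningful
  only at positions not before its left end.\<close>

lemma emit_while:
  assumes b: "11 < b" and E: "regs u b \<le> n" and one: "regs u 20 = 1"
    and test: "\<And>s. same (insert 3 {12..}) u s \<Longrightarrow> a \<le> regs s 2 \<Longrightarrow> regs s 2 < regs u b \<Longrightarrow>
      implements_test test P s"
  shows "same (insert 3 {12..}) u s \<Longrightarrow> a \<le> regs s 2 \<Longrightarrow>
    regs s 11 = of_bool (regs s 2 < regs u b) \<Longrightarrow>
    runs w T D (While 11 (Seq test (block [If 4 (Emit 9) Skip, Op Add 2 2 20, Op Less 11 2 b])))
      s (1 + 28 * (regs u b - regs s 2))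
      (\<lambda>s'. emitted s' = emitted s @ map ((!) T) (filter (\<lambda>p. P p (regs u 3)) [regs s 2..<regs u b]) \<and>
        same (insert 3 {12..}) u s')"
proof (induction "regs u b - regs s 2" arbitrary: s)
  case 0
  let ?body = "block [If 4 (Emit 9) Skip, Op Add 2 2 20, Op Less 11 2 b]"
  have "runs w T D (While 11 (Seq test ?body)) s 1 (\<lambda>s'. emitted s' = emitted s @
      map ((!) T) (filter (\<lambda>p. P p (regs u 3)) [regs s 2..<regs u b]) \<and> same (insert 3 {12..}) u s')"
    using 0 by (intro runs_While_exit) auto
  then show ?case by (rule runs_mono) auto
next
  case (Suc x)
  let ?body = "block [If 4 (Emit 9) Skip, Op Add 2 2 20, Op Less 11 2 b]"
  define p c where "p = regs s 2" and "c = P p (regs u 3)"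
  have p: "p < regs u b" using Suc.hyps(2) by (simp add: p_def)
  have r3: "regs s 3 = regs u 3" using Suc.prems(1) by (simp add: same_def)
  have bnd: "Suc p < 2 ^ w" using fits_self[of "Suc p"] p E by simp
  define out where "out = emitted s @ (if c then [T ! p] else [])"
  let ?R = "\<lambda>s''. emitted s'' = out \<and> same (insert 3 {12..}) u s'' \<and>
      regs s'' 2 = Suc p \<and> regs s'' 11 = of_bool (Suc p < regs u b)"
  let ?Q = "\<lambda>s'. emitted s' = emitted s @
      map ((!) T) (filter (\<lambda>p. P p (regs u 3)) [regs s 2..<regs u b]) \<and> same (insert 3 {12..}) u s'"
  have "runs w T D test s 22 (\<lambda>s'. test_frame s s' \<and> regs s' 4 = of_bool c \<and> regs s' 9 = T ! p)"
    using test[OF Suc.prems(1,2)] p by (simp add: implements_test_def p_def c_def r3)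
  moreover have "runs w T D ?body s' 5 ?R"
    if "test_frame s s' \<and> regs s' 4 = of_bool c \<and> regs s' 9 = T ! p" for s'
  proof (rule wp_runs_le)
    have "regs s' 2 = p" "regs s' 3 = regs u 3" "regs s' b = regs u b" "regs s' 20 = 1"
      "\<And>x. 11 < x \<Longrightarrow> regs s' x = regs u x" "emitted s' = emitted s" "regs s' 4 = of_bool c"
      "regs s' 9 = T ! p"
      using that Suc.prems(1) b one by (auto simp: test_frame_def same_def p_def)
    then show "wp w T D ?body ?R s'"
      using b bnd by (cases c) (simp_all add: take_bit_nat_eq_self same_def out_def)
  qed simp
  ultimately have body: "runs w T D (Seq test ?body) s (22 + 5) ?R"
    by (intro runs_Seq) (auto elim: runs_mono)
  let ?B = "1 + 28 * (regs u b - Suc p)"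
  have "runs w T D (While 11 (Seq test ?body)) s'' ?B ?Q" if s'': "?R s''" for s''
  proof -
    have "emitted s @ map ((!) T) (filter (\<lambda>p. P p (regs u 3)) [p..<regs u b]) =
      out @ map ((!) T) (filter (\<lambda>p. P p (regs u 3)) [Suc p..<regs u b])"
      using p by (simp add: upt_conv_Cons out_def c_def)
    then show ?thesis
      using Suc.hyps(1)[of s''] Suc.hyps(2) Suc.prems(2) s'' by (simp add: p_def)
  qed
  then have "runs w T D (Seq test ?body) s 27 (\<lambda>s''. runs w T D (While 11 (Seq test ?body)) s'' ?B ?Q)"
    using body by (auto elim: runs_mono)
  then have "runs w T D (While 11 (Seq test ?body)) s (1 + 27 + ?B) ?Q"
    using Suc.prems(3) p by (intro runs_While_step) (auto simp: p_def)
  then show ?case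
    by (rule runs_mono) (use p in \<open>auto simp: p_def\<close>)
qed

lemma emit_loop:
  assumes b: "11 < b" and E: "regs s b \<le> n" and one: "regs s 20 = 1"
    and test: "\<And>s'. same (insert 3 {12..}) s s' \<Longrightarrow> regs s 2 \<le> regs s' 2 \<Longrightarrow> regs s' 2 < regs s b \<Longrightarrow>
      implements_test test P s'"
  shows "runs w T D (emit_loop test b) s (2 + 28 * (regs s b - regs s 2))
      (\<lambda>s'. emitted s' = emitted s @ map ((!) T) (filter (\<lambda>p. P p (regs s 3)) [regs s 2..<regs s b]) \<and>
        same (insert 3 {12..}) s s')"
proof -
  let ?s = "s\<lparr>regs := (regs s)(11 := of_bool (regs s 2 < regs s b))\<rparr>"
  have "same (insert 3 {12..}) s ?s" by (simp add: same_def)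
  from emit_while[where P = P and u = s and ?a.0 = "regs s 2", OF b E one test this]
  have "runs w T D (Op Less 11 2 b) s 1 (\<lambda>s'. runs w T D
     (While 11 (Seq test (block [If 4 (Emit 9) Skip, Op Add 2 2 20, Op Less 11 2 b])))
     s' (1 + 28 * (regs s b - regs s 2))
     (\<lambda>s'. emitted s' = emitted s @ map ((!) T) (filter (\<lambda>p. P p (regs s 3)) [regs s 2..<regs s b]) \<and>
        same (insert 3 {12..}) s s'))"
    by (intro wp_runs_le) simp_all
  from runs_Seq[OF this] show ?thesis
    unfolding emit_loop_def by (rule runs_mono) auto
qed

end

section \<open>Scanning the run of full blocks\<close>

lemma runs_Seq_post:
  assumes "runs w T D p s a P" "\<And>s'. P s' \<Longrightarrow> runs w T D q s' b Q"
  shows "runs w T D (Seq p q) s (a + b) Q"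
  using assms by (intro runs_Seq) (auto elim: runs_mono)

text \<open>The first occurrence of a character that attains the maximum lies in one of the blocks i
  to j - 1, so the \<open>LEAST\<close> is attained. Minimality gives the last claim, which permits
  skipping the blocks before \<open>g\<close>.\<close>

lemma next_block:
  fixes T :: "nat list" and d i j :: nat
  assumes d: "0 < d" and ij: "i < j"
  defines "M \<equiv> max_occ T (i * d) (j * d)" and "g \<equiv> next_block T d i j"
  shows "i \<le> g" and "g < j"
    and "\<exists>p \<in> {g * d..<(g + 1) * d}. M \<le> occ T (T ! p) p (j * d)"
    and "\<And>p. i * d \<le> p \<Longrightarrow> p < g * d \<Longrightarrow> occ T (T ! p) p (j * d) < M"
proof -
  let ?G = "\<lambda>g. i \<le> g \<and> (\<exists>p \<in> {g * d..<(g + 1) * d}. M \<le> occ T (T ! p) p (j * d))"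
  have g: "g = (LEAST g. ?G g)" by (simp add: g_def M_def next_block_def)
  have block: "p \<in> {p div d * d..<(p div d + 1) * d}" for p
    using dividend_less_div_times[OF d, of p] by (simp add: algebra_simps)
  have M: "0 < M" unfolding M_def using d ij by (intro max_occ_pos) simp
  obtain c where c: "occ T c (i * d) (j * d) = M" using max_occ_attained M_def by blast
  then obtain x where x: "i * d \<le> x" "x < j * d" "T ! x = c" "occ T c (i * d) x = 0"
    using occ_first M by metis
  then have "M \<le> occ T (T ! x) x (j * d)"
    using occ_split[of "i * d" x "j * d" T c] c by simp
  moreover have ix: "i \<le> x div d" "x div d < j"
    using x d by (simp_all add: less_eq_div_iff_mult_less_eq div_less_iff_less_mult)
  ultimately have G: "?G (x div d)" using block by blast
  show "i \<le> g" "\<exists>p \<in> {g * d..<(g + 1) * d}. M \<le> occ T (T ! p) p (j * d)"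
    using LeastI[of ?G, OF G] unfolding g by blast+
  show "g < j" using Least_le[of ?G, OF G] ix unfolding g by simp
  fix p assume p: "i * d \<le> p" "p < g * d"
  then have "p div d < g" "i \<le> p div d"
    using d by (simp_all add: less_eq_div_iff_mult_less_eq div_less_iff_less_mult)
  then have "\<not> ?G (p div d)" using not_less_Least[of _ ?G] unfolding g by blast
  then show "occ T (T ! p) p (j * d) < M" using block \<open>i \<le> p div d\<close> by (metis not_le)
qed

context mode_table
begin

text \<open>A query that starts strictly inside the last, incomplete block has its start rounded up
  to the row n div d + 1; this is why \<open>W\<close> exceeds n div d by 2.\<close>

lemma span_index: "i \<le> n div d + 1 \<Longrightarrow> j \<le> n div d \<Longrightarrow> i * W + j + 2 \<le> W * W"
  using mult_right_mono[of i "n div d + 1" W] unfolding W_def by (simp add: algebra_simps)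

lemma wp_get_span:
  assumes r: "ready s" and i: "regs s 12 = i" "i \<le> n div d + 1" and j: "regs s 33 = j" "j \<le> n div d"
    and Q: "\<And>x. Q (s\<lparr>regs := (regs s)
      (13 := 2 * n + 2 * (i * W + j), 10 := x, 14 := max_occ T (i * d) (j * d))\<rparr>)"
  shows "wp w T D get_span Q s"
proof -
  have r: "regs s 21 = k" "regs s 22 = 2 ^ k" "regs s 23 = base" "regs s 25 = W" "regs s 26 = 2 * n"
    using r by (simp_all add: ready_def)
  have ix: "i * W + j + 2 \<le> W * W" using span_index i j by simp
  have tb: "take_bit w (i * W) = i * W" "take_bit w (i * W + j) = i * W + j"
    "take_bit w (2 * (i * W + j)) = 2 * (i * W + j)"
    "take_bit w (2 * (i * W + j) + 2 * n) = 2 * (i * W + j) + 2 * n"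
    using ix by (auto intro!: take_bit_nat_eq_self fits_self)
  have dbl: "i * W + j + (i * W + j) = 2 * (i * W + j)" by simp
  have le: "2 * (i * W + j) + 2 * n \<le> 3 * n + 2 * (W * W)" using ix by simp
  have "fld (2 * (i * W + j) + 2 * n) = max_occ T (i * d) (j * d)"
    using occ_field[OF i(2) j(2)] by (simp add: add.commute)
  then show ?thesis
    using le Q[of "data_word w D (base + (2 * (i * W + j) + 2 * n) * k)"]
    by (simp add: get_span_def wp_get_field r i(1) j(1) tb dbl add.commute[of "2 * n"]
        del: add_mult_distrib2 distrib_left_numeral)
qed

lemma runs_get_span:
  assumes "ready s" "regs s 12 = i" "i \<le> n div d + 1" "regs s 33 = j" "j \<le> n div d"
  shows "runs w T D get_span s 10 (\<lambda>s'. emitted s' = emitted s \<and>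
    same (insert 3 ({11..} - {13, 14})) s s' \<and> regs s' 13 = 2 * n + 2 * (i * W + j) \<and>
    regs s' 14 = max_occ T (i * d) (j * d))" (is "runs w T D get_span s 10 ?Q")
proof (rule wp_runs_le)
  show "wp w T D get_span ?Q s"
    by (rule wp_get_span[OF assms]) (auto simp: same_def)
qed (simp add: get_span_def get_field_def)

lemma span_head:
  assumes "ready s" "regs s 12 = i" "i < j" "regs s 33 = j" "j \<le> n div d"
    "regs s 13 = 2 * n + 2 * (i * W + j)"
  defines "g \<equiv> next_block T d i j"
  shows "runs w T D (block [Op Add 13 13 20, get_field 14 13, Op Mul 2 14 24, Op Add 12 14 20, Op Mul 16 12 24])
    s 10 (\<lambda>s'. emitted s' = emitted s \<and> same (insert 3 {17..}) s s' \<and> regs s' 12 = Suc g \<and>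
      regs s' 2 = g * d \<and> regs s' 16 = Suc g * d)" (is "runs w T D ?p s 10 ?Q")
proof (rule wp_runs_le)
  have r: "regs s 20 = 1" "regs s 21 = k" "regs s 22 = 2 ^ k" "regs s 23 = base" "regs s 24 = d"
    using assms(1) by (simp_all add: ready_def)
  define q where "q = 2 * n + 2 * (i * W + j)"
  have ix: "i * W + j + 2 \<le> W * W" using span_index[of i j] assms by simp
  then have q: "Suc q \<le> 3 * n + 2 * (W * W)" unfolding q_def by simp
  have fld: "fld (Suc q) = g" using next_field[OF assms(3,5)] by (simp add: q_def g_def)
  have gj: "g < j" using next_block(2)[OF d_pos assms(3)] by (simp add: g_def)
  have "Suc g * d \<le> n div d * d" using gj assms(5) by (intro mult_right_mono) auto
  also have "\<dots> \<le> n" by simp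
  finally have gd: "Suc g * d \<le> n" .
  moreover have "Suc g \<le> Suc g * d" using d_pos by (cases d) auto
  ultimately have tb: "take_bit w (Suc q) = Suc q" "take_bit w (g * d) = g * d"
    "take_bit w (Suc g) = Suc g" "take_bit w (Suc g * d) = Suc g * d"
    using q by (auto intro!: take_bit_nat_eq_self fits_self)
  have "regs s 13 = q" using assms(6) by (simp add: q_def)
  then show "wp w T D ?p ?Q s"
    using q by (simp add: wp_get_field r tb fld same_def del: mult_Suc)
qed (simp add: get_field_def)

text \<open>The cost is charged to the output: a round costs 24 + 28 * d and reports at least one
  position of block g, so the length of the filtered list bounds the number of rounds. The condition
  on \<open>i\<close>, \<open>j\<close> and \<open>R\<close> ensures that [i * d, R) is either the
  run of blocks i to j - 1 or empty.\<close>

lemma span_loop: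
  assumes N: "0 < N" and j: "j \<le> n div d" and R: "R \<le> n"
  shows "ready s \<Longrightarrow> regs s 17 = N \<Longrightarrow> regs s 3 = N - 1 \<Longrightarrow> regs s 29 = R \<Longrightarrow> regs s 33 = j \<Longrightarrow>
    regs s 12 = i \<Longrightarrow> i \<le> n div d + 1 \<Longrightarrow> (if i < j then R = j * d else R \<le> i * d) \<Longrightarrow>
    max_occ T (i * d) (j * d) \<le> N \<Longrightarrow> regs s 13 = 2 * n + 2 * (i * W + j) \<Longrightarrow>
    regs s 15 = of_bool (max_occ T (i * d) (j * d) = N) \<Longrightarrow>
    runs w T D span_loop s
      (1 + (24 + 28 * d) * length (filter (\<lambda>p. N \<le> occ T (T ! p) p R) [i * d..<R]))
      (\<lambda>s'. emitted s' = emitted s @ map ((!) T) (filter (\<lambda>p. N \<le> occ T (T ! p) p R) [i * d..<R]) \<and>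
        same (insert 3 {17..}) s s')"
proof (induction "Suc j - i" arbitrary: s i rule: less_induct)
  case less
  let ?M = "max_occ T (i * d) (j * d)"
  let ?P = "\<lambda>p. N \<le> occ T (T ! p) p R"
  let ?Q = "\<lambda>s'. emitted s' = emitted s @ map ((!) T) (filter ?P [i * d..<R]) \<and> same (insert 3 {17..}) s s'"
  show ?case
  proof (cases "?M = N")
    case False
    have "\<not> ?P p" if "i * d \<le> p" "p < R" for p
    proof -
      have "R = j * d" using less.prems(8) that by (auto split: if_splits)
      then have "occ T (T ! p) p R \<le> ?M"
        using occ_mono[OF that(1) order.refl] occ_le_max_occ le_trans by blast
      then show ?thesis using False less.prems(9) by simp
    qed
    then have "filter ?P [i * d..<R] = []" by (simp add: filter_empty_conv)
    then show ?thesis unfolding span_loop_def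
      using False less.prems(11) by (intro runs_mono[OF runs_While_exit]) (auto simp: same_refl)
  next
    case True
    \<comment> \<open>For \<open>j \<le> i\<close> the maximum would be 0, whereas \<open>N\<close>
      is positive.\<close>
    have ij: "i < j"
      using True N max_occ_empty[of "j * d" "i * d" T] mult_right_mono[of j i d] by (cases "i < j") auto
    define g where "g = next_block T d i j"
    have nb: "i \<le> g" "g < j" "\<exists>p \<in> {g * d..<Suc g * d}. N \<le> occ T (T ! p) p (j * d)"
      "\<And>p. i * d \<le> p \<Longrightarrow> p < g * d \<Longrightarrow> occ T (T ! p) p (j * d) < N"
      using next_block[OF d_pos ij, where T = T] True by (simp_all add: g_def del: mult_Suc)
    have Rj: "R = j * d" using less.prems(8) ij by simp
    have le: "i * d \<le> g * d" "g * d \<le> Suc g * d" "Suc g * d \<le> R"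
      using nb(1,2) unfolding Rj by (intro mult_right_mono; simp)+
    \<comment> \<open>Blocks before \<open>g\<close> contribute nothing, block \<open>g\<close>
      contributes \<open>X\<close>, and \<open>Y\<close> is what the induction hypothesis delivers
      for the start \<open>Suc g\<close>.\<close>
    define X Y where "X = filter ?P [g * d..<Suc g * d]" and "Y = filter ?P [Suc g * d..<R]"
    have "[i * d..<R] = [i * d..<g * d] @ [g * d..<Suc g * d] @ [Suc g * d..<R]"
      using le upt_add_eq_append[of "i * d" "g * d" "R - g * d"]
        upt_add_eq_append[of "g * d" "Suc g * d" "R - Suc g * d"] by simp
    moreover have "filter ?P [i * d..<g * d] = []" using nb(4) Rj by (auto simp: filter_empty_conv not_le)
    ultimately have split: "filter ?P [i * d..<R] = X @ Y" by (simp add: X_def Y_def del: mult_Suc)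
    have "X \<noteq> []" using nb(3) Rj by (force simp: X_def filter_empty_conv simp del: mult_Suc)
    then have lenX: "1 \<le> length X" by (cases X) auto
    define body where "body = Seq
     (block [Op Add 13 13 20, get_field 14 13, Op Mul 2 14 24, Op Add 12 14 20, Op Mul 16 12 24])
     (Seq (emit_loop (forward_test 29) 16) (Seq get_span (Op Eq 15 14 17)))"
    have w: "span_loop = While 15 body" by (simp add: span_loop_def body_def)
    let ?H1 = "\<lambda>s'. emitted s' = emitted s \<and> same (insert 3 {17..}) s s' \<and> regs s' 12 = Suc g \<and>
      regs s' 2 = g * d \<and> regs s' 16 = Suc g * d"
    let ?H2 = "\<lambda>s'. emitted s' = emitted s @ map ((!) T) X \<and> same (insert 3 {17..}) s s' \<and>
      regs s' 12 = Suc g"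
    let ?H3 = "\<lambda>s'. emitted s' = emitted s @ map ((!) T) X \<and> same (insert 3 {17..}) s s' \<and>
      regs s' 12 = Suc g \<and> regs s' 13 = 2 * n + 2 * (Suc g * W + j) \<and>
      regs s' 14 = max_occ T (Suc g * d) (j * d)"
    let ?H4 = "\<lambda>s'. emitted s' = emitted s @ map ((!) T) X \<and> same (insert 3 {17..}) s s' \<and>
      regs s' 12 = Suc g \<and> regs s' 13 = 2 * n + 2 * (Suc g * W + j) \<and>
      regs s' 15 = of_bool (max_occ T (Suc g * d) (j * d) = N)"
    have h1: "runs w T D (block [Op Add 13 13 20, get_field 14 13, Op Mul 2 14 24, Op Add 12 14 20,
        Op Mul 16 12 24]) s 10 ?H1"
      using span_head[OF less.prems(1,6) ij less.prems(5) j less.prems(10)] by (simp only: g_def)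
    have h2: "runs w T D (emit_loop (forward_test 29) 16) s' (2 + 28 * d) ?H2" if H: "?H1 s'" for s'
    proof -
      have rs': "ready s'" "regs s' 29 = R" "regs s' 3 = N - 1" "regs s' 20 = 1"
        using ready_same[OF less.prems(1)] H less.prems
        by (auto simp: same_def ready_def)
      have "implements_test (forward_test 29) (\<lambda>p m. m < occ T (T ! p) p R) s''"
        if "same (insert 3 {12..}) s' s''" "regs s' 2 \<le> regs s'' 2" "regs s'' 2 < regs s' 16" for s''
      proof -
        have e: "regs s'' 29 = R" "regs s'' 3 = N - 1" using that(1) rs' by (auto simp: same_def)
        have "ready s''" by (rule ready_same[OF rs'(1) that(1)]) auto
        moreover have "N \<le> n" using True max_occ_le[of T "i * d" "j * d"] R Rj by simp
        ultimately show ?thesis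
          using forward_test[of s'' 29, unfolded e] that(3) H le R by auto
      qed
      from emit_loop[where b = 16, OF _ _ rs'(4) this]
      have "runs w T D (emit_loop (forward_test 29) 16) s' (2 + 28 * (Suc g * d - g * d))
        (\<lambda>s''. emitted s'' = emitted s' @ map ((!) T)
            (filter (\<lambda>p. N - 1 < occ T (T ! p) p R) [g * d..<Suc g * d]) \<and>
          same (insert 3 {12..}) s' s'')"
        using H le R rs' by (simp del: mult_Suc)
      moreover have "Suc g * d - g * d = d" by simp
      ultimately have "runs w T D (emit_loop (forward_test 29) 16) s' (2 + 28 * d)
        (\<lambda>s''. emitted s'' = emitted s' @ map ((!) T)
            (filter (\<lambda>p. N - 1 < occ T (T ! p) p R) [g * d..<Suc g * d]) \<and>
          same (insert 3 {12..}) s' s'')" by (simp only:)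
      then show ?thesis
        by (rule runs_mono)
          (use H N in \<open>auto simp: X_def same_def Suc_le_eq[symmetric] simp del: mult_Suc intro!: filter_cong\<close>)
    qed
    have h3: "runs w T D get_span s' 10 ?H3" if H: "?H2 s'" for s'
    proof -
      have "ready s'" using ready_same[OF less.prems(1)] H by auto
      moreover have "regs s' 33 = j" using H less.prems(5) by (auto simp: same_def)
      ultimately show ?thesis
        using runs_get_span[of s' "Suc g" j] H nb(2) j
        by (auto elim!: runs_mono simp: same_def simp del: mult_Suc)
    qed
    have h4: "runs w T D (Op Eq 15 14 17) s' 1 ?H4" if H: "?H3 s'" for s'
    proof -
      have "regs s' 17 = N" using H less.prems(2) by (auto simp: same_def)
      then show ?thesis using H by (intro wp_runs_le) (auto simp: same_def simp del: mult_Suc)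
    qed
    have "runs w T D body s (10 + ((2 + 28 * d) + (10 + 1))) ?H4"
      unfolding body_def by (rule runs_Seq_post[OF h1 runs_Seq_post[OF h2 runs_Seq_post[OF h3 h4]]])
    moreover have "runs w T D span_loop s' (1 + (24 + 28 * d) * length Y) ?Q" if H: "?H4 s'" for s'
    proof -
      have "max_occ T (Suc g * d) (j * d) \<le> N"
        using max_occ_mono[of "i * d" "Suc g * d" "j * d" "j * d" T] le less.prems(9) by linarith
      moreover have "ready s'" using ready_same[OF less.prems(1)] H by auto
      moreover have "regs s' 17 = N" "regs s' 3 = N - 1" "regs s' 29 = R" "regs s' 33 = j"
        using H less.prems by (auto simp: same_def)
      ultimately have "runs w T D span_loop s' (1 + (24 + 28 * d) * length Y)
          (\<lambda>s''. emitted s'' = emitted s' @ map ((!) T) Y \<and> same (insert 3 {17..}) s' s'')"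
        unfolding Y_def using H nb(1,2) j Rj by (intro less.hyps) (auto simp del: mult_Suc)
      then show ?thesis
        by (rule runs_mono) (use H in \<open>auto simp: split same_def\<close>)
    qed
    ultimately have "runs w T D body s (23 + 28 * d)
        (\<lambda>s'. runs w T D span_loop s' (1 + (24 + 28 * d) * length Y) ?Q)"
      by (auto elim!: runs_mono)
    then have "runs w T D span_loop s (1 + (23 + 28 * d) + (1 + (24 + 28 * d) * length Y)) ?Q"
      unfolding w using less.prems(11) True by (intro runs_While_step) auto
    then show ?thesis
    proof (rule runs_mono)
      have "24 + 28 * d \<le> (24 + 28 * d) * length X" using mult_le_mono2[OF lenX, of "24 + 28 * d"] unfolding mult_1_right .
      moreover have "1 + (23 + 28 * d) + (1 + y) \<le> 1 + (x + y)" if "24 + 28 * d \<le> x" for x y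
        using that by simp
      ultimately show "1 + (23 + 28 * d) + (1 + (24 + 28 * d) * length Y) \<le>
          1 + (24 + 28 * d) * length (filter ?P [i * d..<R])"
        unfolding split length_append distrib_left by blast
    qed
  qed
qed

section \<open>A complete query\<close>

lemma runs_init_range:
  fixes l r :: nat
  assumes s: "regs s 0 = l" "regs s 1 = r" "regs s 20 = 1" "regs s 21 = k" "regs s 22 = 2 ^ k"
      "regs s 23 = base" "regs s 24 = d" "regs s 25 = W" "regs s 31 = n" "regs s 32 = 0"
    and lr: "l \<le> r" "r < n"
  defines "i \<equiv> (l + d - 1) div d" and "j \<equiv> Suc r div d"
  defines "L \<equiv> min (i * d) (Suc r)"
  defines "R \<equiv> max L (j * d)"
  shows "runs w T D init_range s 27 (\<lambda>s'. emitted s' = emitted s \<and> ready s' \<and> regs s' 28 = l \<and>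
      regs s' 27 = Suc r \<and> regs s' 33 = j \<and> regs s' 12 = i \<and> regs s' 30 = L \<and> regs s' 29 = R \<and>
      regs s' 3 = max_occ T (i * d) (j * d))" (is "runs w T D _ s 27 ?Q")
proof -
  have id: "i * d \<le> l + d - 1" and jd: "j * d \<le> Suc r" by (simp_all add: i_def j_def)
  have "i \<le> (n + d) div d" unfolding i_def using lr by (intro div_le_mono) auto
  then have i: "i \<le> n div d + 1" using d_pos by simp
  have j: "j \<le> n div d" unfolding j_def using lr by (intro div_le_mono) auto
  have sm: "l + d < 2 ^ w" "Suc r < 2 ^ w" "n + n < 2 ^ w"
    using small lr fits_self[of "n + n"] by auto
  then have tb: "take_bit w (Suc r) = Suc r" "take_bit w (n + n) = n + n" "take_bit w (l + d) = l + d"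
    "take_bit w (i * d) = i * d" "take_bit w (j * d) = j * d"
    "take_bit w (l + d + 2 ^ w - Suc 0) = l + d - 1"
    using id jd d_pos take_bit_sub_eq[of 1 "l + d" w] by (auto intro!: take_bit_nat_eq_self)
  let ?p = "block
     [Op Add 26 31 31, Op And 28 0 0, Op Add 27 1 20, Op Div 33 27 24,
      Op Add 12 28 24, Op Sub 12 12 20, Op Div 12 12 24,
      Op Mul 2 12 24, Op Less 3 2 27, If 3 (Op And 30 2 2) (Op And 30 27 27),
      Op Mul 2 33 24, Op Less 3 30 2, If 3 (Op And 29 2 2) (Op And 29 30 30)]"
  let ?H1 = "\<lambda>s'. emitted s' = emitted s \<and> ready s' \<and> regs s' 28 = l \<and>
      regs s' 27 = Suc r \<and> regs s' 33 = j \<and> regs s' 12 = i \<and> regs s' 30 = L \<and> regs s' 29 = R"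
  let ?H2 = "\<lambda>s'. ?H1 s' \<and> regs s' 14 = max_occ T (i * d) (j * d)"
  have h1: "runs w T D ?p s 16 ?H1"
  proof (rule wp_runs_le)
    show "wp w T D ?p ?H1 s"
    proof (cases "i * d < Suc r")
      case True
      then show ?thesis
        by (cases "i * d < j * d")
          (use d_pos in \<open>auto simp: s s(2)[unfolded One_nat_def] tb i_def[symmetric, unfolded One_nat_def] j_def[symmetric] ready_def L_def R_def
            min_def max_def mult_2\<close>)
    next
      case False
      then show ?thesis
        by (cases "Suc r < j * d")
          (use d_pos in \<open>auto simp: s s(2)[unfolded One_nat_def] tb i_def[symmetric, unfolded One_nat_def] j_def[symmetric] ready_def L_def R_def
            min_def max_def mult_2\<close>)
    qed
  qed simp
  have h2: "runs w T D get_span s' 10 ?H2" if H: "?H1 s'" for s'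
  proof -
    have "runs w T D get_span s' 10 (\<lambda>s''. emitted s'' = emitted s' \<and>
      same (insert 3 ({11..} - {13, 14})) s' s'' \<and> regs s'' 13 = 2 * n + 2 * (i * W + j) \<and>
      regs s'' 14 = max_occ T (i * d) (j * d))"
      using H i j by (intro runs_get_span) blast+
    then show ?thesis
    proof (rule runs_mono)
      fix s'' assume s'': "emitted s'' = emitted s' \<and> same (insert 3 ({11..} - {13, 14})) s' s'' \<and>
        regs s'' 13 = 2 * n + 2 * (i * W + j) \<and> regs s'' 14 = max_occ T (i * d) (j * d)"
      then have "same ({12} \<union> {17..}) s' s''" by (auto simp: same_def)
      moreover from this have "ready s''" using H ready_same[of s' "{12} \<union> {17..}" s''] by blast
      ultimately show "?H2 s''" using H s'' by (simp add: same_def)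
    qed simp
  qed
  have h3: "runs w T D (Op And 3 14 14) s' 1 ?Q" if H: "?H2 s'" for s'
    by (rule wp_runs_le) (use H in \<open>auto simp: ready_def\<close>)
  have "runs w T D init_range s (16 + (10 + 1)) ?Q"
    unfolding init_range_def by (rule runs_Seq_post[OF h1 runs_Seq_post[OF h2 h3]])
  then show ?thesis by simp
qed

text \<open>Decoding the header depends on the concrete encoding, so its outcome is a hypothesis
  here. The phases of cost O(d) fit the bound because a non-empty range has at least one
  mode.\<close>

lemma runs_mode_query:
  fixes l r :: nat
  assumes lr: "l \<le> r" "r < n"
    and header: "runs w T D init_header (query_state l r) 40 (\<lambda>s. emitted s = [] \<and> regs s 0 = l \<and>
      regs s 1 = r \<and> regs s 20 = 1 \<and> regs s 21 = k \<and> regs s 22 = 2 ^ k \<and> regs s 23 = base \<and>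
      regs s 24 = d \<and> regs s 25 = W \<and> regs s 31 = n \<and> regs s 32 = 0)"
      (is "runs w T D _ _ _ ?H0")
  defines "M \<equiv> {c. occ T c l (Suc r) = max_occ T l (Suc r)}"
  shows "runs w T D mode_query (query_state l r) (400 * d * card M)
    (\<lambda>s. distinct (emitted s) \<and> set (emitted s) = M)"
proof -
  define e N where "e = Suc r" and "N = max_occ T l e"
  define i j where "i = (l + d - 1) div d" and "j = e div d"
  define L where "L = min (i * d) e"
  define R where "R = max L (j * d)"
  define F where "F = max_occ T (i * d) (j * d)"
  have le: "l < e" "e \<le> n" using lr by (simp_all add: e_def)
  have i: "i * d \<le> l + d - 1" "l + d - 1 < i * d + d"
    using dividend_less_div_times[OF d_pos, of "l + d - 1"] by (simp_all add: i_def)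
  have j: "j * d \<le> e" "e < j * d + d"
    using dividend_less_div_times[OF d_pos, of e] by (simp_all add: j_def)
  have "i \<le> (n + d) div d" unfolding i_def using lr by (intro div_le_mono) auto
  then have i_le: "i \<le> n div d + 1" using d_pos by simp
  have j_le: "j \<le> n div d" unfolding j_def using le by (intro div_le_mono) auto
  have ij: "i < j \<Longrightarrow> i * d + d \<le> j * d" "j < i \<Longrightarrow> j * d + d \<le> i * d"
    using mult_right_mono[of "Suc i" j d] mult_right_mono[of "Suc j" i d] by auto
  have bounds: "l \<le> L" "L \<le> R" "R \<le> e" "L \<le> l + d" "e \<le> R + d"
    using i j le d_pos by (auto simp: L_def R_def)
  have R_cases: "if i < j then R = j * d else R \<le> i * d"
    using ij j i by (cases i j rule: linorder_cases) (auto simp: L_def R_def)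
  have L_eq: "i < j \<Longrightarrow> L = i * d" using ij j by (auto simp: L_def)
  \<comment> \<open>With no full block inside the query both sides are 0: [L, R) is empty and
    \<open>j * d \<le> i * d\<close>.\<close>
  have F: "F = max_occ T L R"
  proof (cases "i < j")
    case True then show ?thesis using L_eq R_cases by (simp add: F_def)
  next
    case False
    then have "R \<le> L" using R_cases bounds by (auto simp: L_def)
    moreover have "j * d \<le> i * d" using False by simp
    ultimately show ?thesis by (simp add: F_def max_occ_empty)
  qed
  have N: "0 < N" unfolding N_def using le by (intro max_occ_pos)
  have Nn: "N \<le> n" using max_occ_le[of T l e] le by (simp add: N_def)
  have FN: "F \<le> N" unfolding F N_def using bounds by (intro max_occ_mono) auto
  \<comment> \<open>A mode has at most d occurrences in the prefix and at most d in the suffix; this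
    bounds the number of increments.\<close>
  have NF: "N \<le> F + 2 * d"
  proof -
    obtain c where "occ T c l e = N" using max_occ_attained N_def by blast
    then have "N = occ T c l L + (occ T c L R + occ T c R e)"
      using occ_split[of l L e T c] occ_split[of L R e T c] bounds by simp
    then show ?thesis
      using occ_le[of T c l L] occ_le[of T c R e] occ_le_max_occ[of T c L R] bounds unfolding F by linarith
  qed
  define p1 p2 p3 where "p1 = filter (\<lambda>p. N \<le> occ T (T ! p) p e) [l..<L]"
    and "p2 = filter (\<lambda>p. N \<le> occ T (T ! p) p R) [L..<R]"
    and "p3 = filter (\<lambda>p. N \<le> occ T (T ! p) L (Suc p)) [R..<e]"
  \<comment> \<open>The program scans from \<open>i * d\<close>, not from \<open>L\<close>; the two
    differ only when the run is empty.\<close>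
  have p2: "p2 = filter (\<lambda>p. N \<le> occ T (T ! p) p R) [i * d..<R]"
  proof (cases "i < j")
    case False
    then have "R \<le> L" "R \<le> i * d" using R_cases bounds by (auto simp: L_def)
    then show ?thesis by (simp add: p2_def)
  qed (simp add: p2_def L_eq)
  have ps: "distinct (map ((!) T) (p1 @ p2 @ p3))" "set (map ((!) T) (p1 @ p2 @ p3)) = M"
    using mode_positions[OF bounds(1-3) le(1)] by (simp_all add: p1_def p2_def p3_def M_def N_def e_def)
  have len: "length p1 + length p2 + length p3 = card M"
    using distinct_card[OF ps(1)] unfolding ps(2) by simp
  have "M \<noteq> {}" using max_occ_attained[of T l "Suc r"] by (auto simp: M_def)
  moreover have "finite M" using ps(2) by (metis List.finite_set)
  ultimately have M: "1 \<le> card M" by (simp add: card_gt_0_iff Suc_le_eq)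

  define cfg where "cfg s \<longleftrightarrow> ready s \<and> regs s 28 = l \<and> regs s 27 = e \<and> regs s 33 = j \<and>
    regs s 12 = i \<and> regs s 30 = L \<and> regs s 29 = R" for s
  have cfg_same: "cfg s'" if "cfg s" "same X s s'" "{12} \<union> {17..} \<subseteq> X" for s s' X
    using that ready_same[of s X s'] unfolding cfg_def same_def by (simp add: subset_iff)
  have le_iff: "N - 1 < x \<longleftrightarrow> N \<le> x" for x using N by auto

  define Inv1 where "Inv1 p G \<longleftrightarrow> F \<le> G \<and> G \<le> N \<and> l \<le> p \<and> (\<forall>x. l \<le> x \<longrightarrow> x < p \<longrightarrow> occ T (T ! x) x e \<le> G)"
    for p G
  define Inv2 where "Inv2 p G \<longleftrightarrow> Inv1 L G \<and> R \<le> p \<and> (\<forall>x. R \<le> x \<longrightarrow> x < p \<longrightarrow> occ T (T ! x) l (Suc x) \<le> G)"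
    for p G
  \<comment> \<open>A mode that meets the prefix is caught at its first occurrence, one that meets
    the suffix at its last, and one that meets neither is counted in \<open>F\<close>.\<close>
  have final: "G = N" if "Inv2 e G" for G
  proof (rule antisym)
    show "G \<le> N" using that by (simp add: Inv2_def Inv1_def)
    obtain c where c: "occ T c l e = N" using max_occ_attained N_def by blast
    consider "0 < occ T c l L" | "0 < occ T c R e" | "occ T c l L = 0" "occ T c R e = 0" by auto
    then show "N \<le> G"
    proof cases
      case 1
      then obtain x where x: "l \<le> x" "x < L" "T ! x = c" "occ T c l x = 0" by (rule occ_first)
      then have "occ T c x e = N" using c occ_split[of l x e T c] bounds by simp
      then show ?thesis using that x by (auto simp: Inv2_def Inv1_def)
    next
      case 2
      then obtain x where x: "R \<le> x" "x < e" "T ! x = c" "occ T c (Suc x) e = 0" by (rule occ_last)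
      then have "occ T c l (Suc x) = N" using c occ_split[of l "Suc x" e T c] bounds by simp
      then show ?thesis using that x by (auto simp: Inv2_def)
    next
      case 3
      then have "occ T c L R = N"
        using c occ_split[of l L e T c] occ_split[of L R e T c] bounds by simp
      then have "N \<le> F" unfolding F using occ_le_max_occ by metis
      then show ?thesis using that by (simp add: Inv2_def Inv1_def)
    qed
  qed

  let ?H1 = "\<lambda>s. emitted s = [] \<and> cfg s \<and> regs s 3 = F"
  have h1: "runs w T D init_range s 27 ?H1" if "?H0 s" for s
    using runs_init_range[of s l r, OF _ _ _ _ _ _ _ _ _ _ lr] that
    by (auto elim!: runs_mono simp: cfg_def e_def i_def j_def L_def R_def F_def)
  let ?H2 = "\<lambda>s. emitted s = [] \<and> cfg s \<and> regs s 3 = F \<and> regs s 2 = l"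
  have h2: "runs w T D (Op And 2 28 28) s 1 ?H2" if "?H1 s" for s
    by (rule wp_runs_le) (use that in \<open>auto simp: cfg_def ready_def\<close>)
  let ?H3 = "\<lambda>s. emitted s = [] \<and> cfg s \<and> Inv1 L (regs s 3)"
  \<comment> \<open>84 * d = 28 * (d + 2 * d): at most d positions are passed and at most 2 * d
    increments made.\<close>
  have h3: "runs w T D (count_loop (forward_test 27) 30) s (2 + 84 * d) ?H3" if H: "?H2 s" for s
  proof -
    have rs: "regs s 30 = L" "regs s 27 = e" "regs s 20 = 1" using H by (auto simp: cfg_def ready_def)
    have "runs w T D (count_loop (forward_test 27) 30) s (2 + 28 * (regs s 30 - regs s 2 + (N - regs s 3)))
      (\<lambda>s'. emitted s' = emitted s \<and> same {12..} s s' \<and> Inv1 (regs s 30) (regs s' 3))"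
    proof (rule count_loop[where P = "\<lambda>p m. m < occ T (T ! p) p e"])
      fix s' assume s': "same {12..} s s'" "regs s' 2 < regs s 30" "Inv1 (regs s' 2) (regs s' 3)"
      have "regs s' 27 = e" "ready s'"
        using cfg_same[OF _ s'(1)] H by (auto simp: cfg_def)
      then show "implements_test (forward_test 27) (\<lambda>p m. m < occ T (T ! p) p e) s'"
        using forward_test[of s' 27] s' rs bounds le Nn by (auto simp: Inv1_def)
    next
      fix p G assume "Inv1 p G" "p < regs s 30" "G < occ T (T ! p) p e"
      moreover have "occ T (T ! p) p e \<le> N" if "l \<le> p"
        using occ_mono[OF that order.refl, of T "T ! p" e] occ_le_max_occ[of T "T ! p" l e]
        unfolding N_def by linarith
      ultimately show "Inv1 p (G + 1)" by (fastforce simp: Inv1_def)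
    next
      fix p G assume "Inv1 p G" "p < regs s 30" "\<not> G < occ T (T ! p) p e"
      then show "Inv1 (p + 1) G" by (auto simp: Inv1_def less_Suc_eq)
    qed (use H rs bounds le Nn FN in \<open>auto simp: Inv1_def\<close>)
    then show ?thesis
      by (rule runs_mono) (use H rs bounds NF in \<open>auto intro: cfg_same\<close>)
  qed
  let ?H4 = "\<lambda>s. emitted s = [] \<and> cfg s \<and> Inv1 L (regs s 3) \<and> regs s 2 = R"
  have h4: "runs w T D (Op And 2 29 29) s 1 ?H4" if "?H3 s" for s
    by (rule wp_runs_le) (use that in \<open>auto simp: cfg_def ready_def\<close>)
  let ?H5 = "\<lambda>s. emitted s = [] \<and> cfg s \<and> regs s 3 = N"
  have h5: "runs w T D (count_loop (backward_test 28) 27) s (2 + 84 * d) ?H5" if H: "?H4 s" for s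
  proof -
    have rs: "regs s 28 = l" "regs s 27 = e" "regs s 20 = 1" using H by (auto simp: cfg_def ready_def)
    have "runs w T D (count_loop (backward_test 28) 27) s (2 + 28 * (regs s 27 - regs s 2 + (N - regs s 3)))
      (\<lambda>s'. emitted s' = emitted s \<and> same {12..} s s' \<and> Inv2 (regs s 27) (regs s' 3))"
    proof (rule count_loop[where P = "\<lambda>p m. m < occ T (T ! p) l (Suc p)"])
      fix s' assume s': "same {12..} s s'" "regs s' 2 < regs s 27" "Inv2 (regs s' 2) (regs s' 3)"
      have "regs s' 28 = l" "ready s'"
        using cfg_same[OF _ s'(1)] H by (auto simp: cfg_def)
      then show "implements_test (backward_test 28) (\<lambda>p m. m < occ T (T ! p) l (Suc p)) s'"
        using backward_test[of s' 28] s' rs bounds le Nn by (auto simp: Inv2_def Inv1_def)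
    next
      fix p G assume "Inv2 p G" "p < regs s 27" "G < occ T (T ! p) l (Suc p)"
      moreover have "occ T (T ! p) l (Suc p) \<le> N" if "p < e"
        using occ_mono[OF order.refl, of "Suc p" e T "T ! p" l] occ_le_max_occ[of T "T ! p" l e] that
        unfolding N_def by linarith
      ultimately show "Inv2 p (G + 1)" using rs by (fastforce simp: Inv2_def Inv1_def)
    next
      fix p G assume "Inv2 p G" "p < regs s 27" "\<not> G < occ T (T ! p) l (Suc p)"
      then show "Inv2 (p + 1) G" by (auto simp: Inv2_def less_Suc_eq)
    qed (use H rs bounds le Nn in \<open>auto simp: Inv2_def Inv1_def\<close>)
    moreover have "F \<le> regs s 3" using H by (simp add: Inv1_def)
    ultimately show ?thesis
      by (elim runs_mono) (use H rs bounds NF in \<open>auto intro: cfg_same final\<close>)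
  qed
  define cfg' where "cfg' s \<longleftrightarrow> cfg s \<and> regs s 17 = N \<and> regs s 3 = N - 1" for s
  have cfg'_same: "cfg' s'" if "cfg' s" "same X s s'" "{3, 12} \<union> {17..} \<subseteq> X" for s s' X
    using that cfg_same[of s X s'] unfolding cfg'_def same_def by (simp add: subset_iff)
  let ?H6 = "\<lambda>s. emitted s = [] \<and> cfg' s \<and> regs s 2 = l"
  have h6: "runs w T D (block [Op And 17 3 3, Op Sub 3 3 20, Op And 2 28 28]) s 4 ?H6" if H: "?H5 s" for s
  proof (rule wp_runs_le)
    have "N < 2 ^ w" using fits_self[of N] Nn by simp
    then have "take_bit w (N + 2 ^ w - Suc 0) = N - 1" using N take_bit_sub_eq[of 1 N w] by simp
    then show "wp w T D (block [Op And 17 3 3, Op Sub 3 3 20, Op And 2 28 28]) ?H6 s"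
      using H by (auto simp: cfg'_def cfg_def ready_def)
  qed simp
  let ?H7 = "\<lambda>s. emitted s = map ((!) T) p1 \<and> cfg' s"
  have h7: "runs w T D (emit_loop (forward_test 27) 30) s (2 + 28 * d) ?H7" if H: "?H6 s" for s
  proof -
    have rs: "regs s 30 = L" "regs s 20 = 1" "regs s 3 = N - 1"
      using H by (auto simp: cfg'_def cfg_def ready_def)
    have "runs w T D (emit_loop (forward_test 27) 30) s (2 + 28 * (regs s 30 - regs s 2))
      (\<lambda>s'. emitted s' = emitted s @ map ((!) T)
          (filter (\<lambda>p. regs s 3 < occ T (T ! p) p e) [regs s 2..<regs s 30]) \<and>
        same (insert 3 {12..}) s s')"
    proof (rule emit_loop[where P = "\<lambda>p m. m < occ T (T ! p) p e"])
      fix s' assume s': "same (insert 3 {12..}) s s'" "regs s' 2 < regs s 30"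
      have "cfg' s'" by (rule cfg'_same[OF _ s'(1)]) (use H in auto)
      then have "regs s' 27 = e" "ready s'" "regs s' 3 = N - 1" by (auto simp: cfg_def cfg'_def)
      then show "implements_test (forward_test 27) (\<lambda>p m. m < occ T (T ! p) p e) s'"
        using forward_test[of s' 27] s' rs bounds le Nn by auto
    qed (use rs bounds le in auto)
    then show ?thesis
      by (rule runs_mono) (use H rs bounds in \<open>auto intro: cfg'_same simp: p1_def le_iff[unfolded One_nat_def]\<close>)
  qed
  let ?H8 = "\<lambda>s. ?H7 s \<and> regs s 13 = 2 * n + 2 * (i * W + j) \<and> regs s 15 = of_bool (F = N)"
  have h8: "runs w T D (Seq get_span (Op Eq 15 14 17)) s (10 + 1) ?H8" if H: "?H7 s" for s
  proof (rule runs_Seq_post[OF runs_get_span[OF _ _ i_le _ j_le]])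
    fix s' assume s': "emitted s' = emitted s \<and> same (insert 3 ({11..} - {13, 14})) s s' \<and>
      regs s' 13 = 2 * n + 2 * (i * W + j) \<and> regs s' 14 = max_occ T (i * d) (j * d)"
    then have same: "same (insert 3 ({11..} - {13, 14})) s s'" by blast
    have "cfg' s'" by (rule cfg'_same[OF _ same]) (use H in auto)
    then show "runs w T D (Op Eq 15 14 17) s' 1 ?H8"
      by (intro wp_runs_le) (use H s' in \<open>auto simp: cfg'_def cfg_def ready_def F_def\<close>)
  qed (use H in \<open>auto simp: cfg'_def cfg_def\<close>)
  let ?H9 = "\<lambda>s. emitted s = map ((!) T) (p1 @ p2) \<and> ready s \<and> regs s 27 = e \<and> regs s 29 = R \<and>
    regs s 30 = L \<and> regs s 3 = N - 1"
  have h9: "runs w T D span_loop s (1 + (24 + 28 * d) * length p2) ?H9" if H: "?H8 s" for s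
  proof (rule runs_mono)
    show "runs w T D span_loop s
      (1 + (24 + 28 * d) * length (filter (\<lambda>p. N \<le> occ T (T ! p) p R) [i * d..<R]))
      (\<lambda>s'. emitted s' = emitted s @ map ((!) T) (filter (\<lambda>p. N \<le> occ T (T ! p) p R) [i * d..<R]) \<and>
        same (insert 3 {17..}) s s')"
      by (rule span_loop[OF N j_le, of R s i])
        (use H i_le R_cases FN bounds le in \<open>auto simp: cfg'_def cfg_def F_def split: if_splits\<close>)
    fix s' assume s': "emitted s' = emitted s @ map ((!) T) (filter (\<lambda>p. N \<le> occ T (T ! p) p R) [i * d..<R]) \<and>
        same (insert 3 {17..}) s s'"
    then have same: "same (insert 3 {17..}) s s'" by blast
    have "ready s'" by (rule ready_same[OF _ same]) (use H in \<open>auto simp: cfg'_def cfg_def\<close>)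
    then show "?H9 s'" using H s' by (auto simp: cfg'_def cfg_def same_def p2)
  qed (simp add: p2)
  let ?H10 = "\<lambda>s. ?H9 s \<and> regs s 2 = R"
  have h10: "runs w T D (Op And 2 29 29) s 1 ?H10" if "?H9 s" for s
    by (rule wp_runs_le) (use that in \<open>auto simp: ready_def\<close>)
  let ?H11 = "\<lambda>s. emitted s = map ((!) T) (p1 @ p2 @ p3)"
  have h11: "runs w T D (emit_loop (backward_test 30) 27) s (2 + 28 * d) ?H11" if H: "?H10 s" for s
  proof -
    have rs: "regs s 20 = 1" using H by (auto simp: ready_def)
    have "runs w T D (emit_loop (backward_test 30) 27) s (2 + 28 * (regs s 27 - regs s 2))
      (\<lambda>s'. emitted s' = emitted s @ map ((!) T)
          (filter (\<lambda>p. regs s 3 < occ T (T ! p) L (Suc p)) [regs s 2..<regs s 27]) \<and>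
        same (insert 3 {12..}) s s')"
    proof (rule emit_loop[where P = "\<lambda>p m. m < occ T (T ! p) L (Suc p)"])
      fix s' assume s': "same (insert 3 {12..}) s s'" "regs s 2 \<le> regs s' 2" "regs s' 2 < regs s 27"
      have "ready s'" by (rule ready_same[OF _ s'(1)]) (use H in auto)
      moreover have "regs s' 30 = L" "regs s' 3 = N - 1" using s'(1) H by (auto simp: same_def)
      ultimately show "implements_test (backward_test 30) (\<lambda>p m. m < occ T (T ! p) L (Suc p)) s'"
        using backward_test[of s' 30] s' H bounds le Nn by auto
    qed (use rs H le in auto)
    then show ?thesis
      by (rule runs_mono) (use H bounds in \<open>auto simp: p3_def le_iff[unfolded One_nat_def]\<close>)
  qed
  have "runs w T D mode_query (query_state l r)
    (40 + (27 + (1 + ((2 + 84 * d) + (1 + ((2 + 84 * d) + (4 + ((2 + 28 * d) + ((10 + 1) +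
      ((1 + (24 + 28 * d) * length p2) + (1 + (2 + 28 * d)))))))))))) ?H11"
    unfolding mode_query_def
    by (rule runs_Seq_post[OF header runs_Seq_post[OF h1 runs_Seq_post[OF h2 runs_Seq_post[OF h3
      runs_Seq_post[OF h4 runs_Seq_post[OF h5 runs_Seq_post[OF h6 runs_Seq_post[OF h7 runs_Seq_post[OF h8
      runs_Seq_post[OF h9 runs_Seq_post[OF h10 h11]]]]]]]]]]])
  then show ?thesis
  proof (rule runs_mono)
    have "length p2 \<le> card M" using len by simp
    \<comment> \<open>52 = 24 + 28, using d \<ge> 1. The whole sum is then at most 94 + 224 * d + 52
      * d * card M, and \<open>d * card M\<close> is at least 1 and at least d.\<close>
    then have "(24 + 28 * d) * length p2 \<le> (52 * d) * card M" using d_pos by (intro mult_mono) auto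
    moreover have "d \<le> d * card M" "1 \<le> d * card M" using M d_pos by auto
    ultimately show "40 + (27 + (1 + ((2 + 84 * d) + (1 + ((2 + 84 * d) + (4 + ((2 + 28 * d) + ((10 + 1) +
      ((1 + (24 + 28 * d) * length p2) + (1 + (2 + 28 * d))))))))))) \<le> 400 * d * card M"
      unfolding mult.assoc by linarith
  qed (use ps in auto)
qed

end

section \<open>The encoding of the data structure\<close>

definition encode :: "nat \<Rightarrow> nat list \<Rightarrow> bool list" where
  "encode k xs = replicate k True @ False # concat (map (\<lambda>x. map (bit x) [0..<k]) xs)"

lemma length_encode: "length (encode k xs) = k + 1 + length xs * k"
  by (induction xs) (simp_all add: encode_def)

lemma drop_concat_fields:
  "drop (q * k) (concat (map (\<lambda>x. map (bit x) [0..<k]) xs)) =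
    concat (map (\<lambda>x. map (bit x) [0..<k]) (drop q xs))"
proof (induction q arbitrary: xs)
  case (Suc q)
  then show ?case by (cases xs) (simp_all add: add.commute flip: drop_drop)
qed simp

text \<open>The visible bits may reach into later fields, which the reduction modulo 2 ^ k removes.
  Here \<open>v\<close> is w in general, and w - k - 1 for the field inside the first word.\<close>

lemma field_value:
  fixes xs :: "nat list"
  assumes "q < length xs" "k \<le> v"
  shows "horner_sum of_bool 2 (take v (concat (map (\<lambda>x. map (bit x) [0..<k]) (drop q xs)))) mod 2 ^ k =
    xs ! q mod 2 ^ k"
proof -
  have "take k (concat (map (\<lambda>x. map (bit x) [0..<k]) (drop q xs))) = map (bit (xs ! q)) [0..<k]"
    using assms(1) by (simp flip: Cons_nth_drop_Suc)
  moreover have "min k v = k" using assms(2) by simp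
  ultimately show ?thesis
    by (simp flip: take_bit_eq_mod add: take_bit_horner_sum_bit_eq horner_sum_bit_eq_take_bit)
qed

lemma data_word_field:
  assumes "q < length xs" "k \<le> w"
  shows "data_word w (encode k xs) (k + 1 + q * k) mod 2 ^ k = xs ! q mod 2 ^ k"
proof -
  have "drop (k + 1 + q * k) (encode k xs) = drop (q * k) (concat (map (\<lambda>x. map (bit x) [0..<k]) xs))"
    by (simp add: encode_def)
  then show ?thesis
    using field_value[OF assms] unfolding data_word_def drop_concat_fields by simp
qed

lemma horner_sum_replicate_True: "horner_sum of_bool 2 (replicate k True) = (2 ^ k - 1 :: nat)"
proof -
  have "horner_sum of_bool 2 (replicate k True) + 1 = (2 ^ k :: nat)" by (induction k) simp_all
  then show ?thesis by simp
qed

text \<open>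
  The unary prefix lets a program that knows neither w nor k recover k from the first word x:
  x XOR (x + 1) gives the power of two that separates the
  prefix from the first field, and that field is k itself.
\<close>

lemma data_word_header:
  assumes "2 * k + 1 \<le> w" "0 < length xs"
  obtains y where "data_word w (encode k xs) 0 = 2 ^ k - 1 + 2 ^ (k + 1) * y"
    "y mod 2 ^ k = xs ! 0 mod 2 ^ k" "2 ^ (k + 1) * y + 2 ^ (k + 1) \<le> 2 ^ w"
proof
  let ?b = "take (w - k - 1) (concat (map (\<lambda>x. map (bit x) [0..<k]) xs))"
  define y :: nat where "y = horner_sum of_bool 2 ?b"
  have "take w (encode k xs) = replicate k True @ False # ?b"
    using assms by (simp add: encode_def take_Cons' min_def)
  then show "data_word w (encode k xs) 0 = 2 ^ k - 1 + 2 ^ (k + 1) * y"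
    by (simp add: data_word_def horner_sum_append horner_sum_replicate_True y_def)
  show "y mod 2 ^ k = xs ! 0 mod 2 ^ k"
    using field_value[of 0 xs k "w - k - 1"] assms by (simp add: y_def)
  \<comment> \<open>This bound leaves room for the successor: it keeps x + 1 below 2 ^ w.\<close>
  have "y < 2 ^ length ?b" unfolding y_def by (rule horner_sum_of_bool_2_less)
  also have "\<dots> \<le> 2 ^ (w - k - 1)" by (intro power_increasing) auto
  finally have "2 ^ (k + 1) * (y + 1) \<le> 2 ^ (k + 1) * 2 ^ (w - k - 1)" by (intro mult_left_mono) auto
  also have "\<dots> = 2 ^ (k + 1 + (w - k - 1))" by (simp only: power_add)
  also have "k + 1 + (w - k - 1) = w" using assms by simp
  finally show "2 ^ (k + 1) * y + 2 ^ (k + 1) \<le> 2 ^ w" by simp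
qed

text \<open>In binary the operands are y followed by 0 1...1 and by 1 0...0, so exactly the last k +
  1 bits differ. The induction appends a lowest bit, 1 to the one and 0 to the other.\<close>

lemma xor_successor:
  "xor (2 ^ k - 1 + 2 ^ (k + 1) * y) (2 ^ k + 2 ^ (k + 1) * y) = (2 ^ (k + 1) - 1 :: nat)"
proof (induction k)
  case 0
  have "xor (2 * y) (1 + 2 * y) = Suc 0" by (simp add: xor_nat_rec[of "2 * y"])
  then show ?case by simp
next
  case (Suc k)
  let ?a = "2 ^ k - 1 + 2 ^ (k + 1) * y" and ?b = "2 ^ k + 2 ^ (k + 1) * y"
  obtain z where z: "(2 :: nat) ^ k = Suc z" using gr0_implies_Suc[of "2 ^ k"] by auto
  have "2 ^ Suc k - 1 + 2 ^ (Suc k + 1) * y = 1 + 2 * ?a"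
    using z by (simp add: algebra_simps)
  moreover have "2 ^ Suc k + 2 ^ (Suc k + 1) * y = 2 * ?b" by simp
  moreover have "xor (1 + 2 * a) (2 * b) = 1 + 2 * xor a b" for a b :: nat
    by (subst xor_nat_rec) simp
  ultimately have "xor (2 ^ Suc k - 1 + 2 ^ (Suc k + 1) * y) (2 ^ Suc k + 2 ^ (Suc k + 1) * y) =
      1 + 2 * (2 ^ (k + 1) - 1)"
    by (simp only: Suc)
  then show ?case using z by simp
qed

lemma runs_init_header:
  assumes w: "2 * k + 1 \<le> w" and k: "0 < k" and xs: "4 \<le> length xs"
    and fields: "xs ! 0 = k" "\<And>q. q < 4 \<Longrightarrow> xs ! q < 2 ^ k"
    and fit: "k + 1 + 4 * k < 2 ^ w"
  shows "runs w T (encode k xs) init_header (query_state l r) 40 (\<lambda>s. emitted s = [] \<and> regs s 0 = l \<and>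
      regs s 1 = r \<and> regs s 20 = 1 \<and> regs s 21 = k \<and> regs s 22 = 2 ^ k \<and> regs s 23 = k + 1 + 4 * k \<and>
      regs s 24 = xs ! 1 \<and> regs s 25 = xs ! 2 \<and> regs s 31 = xs ! 3 \<and> regs s 32 = 0)"
    (is "runs w T ?D _ _ _ ?Q")
proof (rule wp_runs_le)
  obtain y where y: "data_word w ?D 0 = 2 ^ k - 1 + 2 ^ (k + 1) * y"
      "y mod 2 ^ k = xs ! 0 mod 2 ^ k" "2 ^ (k + 1) * y + 2 ^ (k + 1) \<le> 2 ^ w"
    using data_word_header[OF w] xs by (metis gr_zeroI not_numeral_le_zero)
  define x where "x = data_word w ?D 0"
  have x: "x + 1 = 2 ^ k + 2 ^ (k + 1) * y" using y(1) one_le_power[of "2::nat" k] by (simp add: x_def)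
  then have xor: "xor x (Suc x) = 2 ^ (k + 1) - 1" using xor_successor[of k y] y(1) by (simp add: x_def)
  have lt: "(2::nat) ^ k < 2 ^ (k + 1)" by simp
  have pw: "(2::nat) ^ (k + 1) < 2 ^ w" using w k by (intro power_strict_increasing) auto
  have "x + 1 < 2 ^ w" unfolding x using y(3) lt by linarith
  then have tb1: "take_bit w (Suc x) = Suc x" by (auto intro: take_bit_nat_eq_self)
  have tb2: "take_bit w (Suc (2 ^ (k + 1) - Suc 0)) = 2 ^ (k + 1)"
    using pw by (auto intro: take_bit_nat_eq_self)
  have dv: "x div 2 ^ (k + 1) = y"
  proof (rule div_nat_eqI)
    show "2 ^ (k + 1) * y \<le> x" unfolding x_def y(1) by (rule le_add2)
    show "x < 2 ^ (k + 1) * Suc y" using x lt unfolding mult_Suc_right by linarith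
  qed
  have md: "y mod 2 ^ k = k" using y(2) fields by simp
  have sh: "drop_bit (Suc 0) (2 * 2 ^ k) = (2 ^ k :: nat)" by (simp add: drop_bit_Suc)
  have small: "take_bit w (Suc k) = Suc k" "take_bit w k = k" "take_bit w (2 * k) = 2 * k"
    "take_bit w (3 * k) = 3 * k" "take_bit w (4 * k) = 4 * k"
    "take_bit w (Suc (2 * k)) = Suc (2 * k)" "take_bit w (Suc (3 * k)) = Suc (3 * k)"
    "take_bit w (Suc (4 * k)) = Suc (4 * k)" "take_bit w (Suc (5 * k)) = Suc (5 * k)"
    "take_bit w (Suc 0) = Suc 0" "take_bit w 2 = (2 :: nat)" "take_bit w 3 = (3 :: nat)"
    "take_bit w 4 = (4 :: nat)"
    using fit k w by (auto intro!: take_bit_nat_eq_self)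
  have field: "data_word w ?D p mod 2 ^ k = xs ! q" if "q < 4" "p = k + 1 + q * k" for p q
    using data_word_field[of q xs k w] fields(2)[of q] that xs w by simp
  have fld: "data_word w ?D (Suc (2 * k)) mod 2 ^ k = xs ! Suc 0"
    "data_word w ?D (Suc (3 * k)) mod 2 ^ k = xs ! 2"
    "data_word w ?D (Suc (4 * k)) mod 2 ^ k = xs ! 3"
    by (rule field; simp)+
  show "wp w T ?D init_header ?Q (query_state l r)"
    using w k by (simp add: init_header_def get_field_def query_state_def x_def[symmetric] tb1 xor
        tb2[simplified] dv[simplified] md sh small fld flip: mult_2)
qed (simp add: init_header_def get_field_def)

section \<open>The data structure of a string\<close>

definition table :: "nat list \<Rightarrow> nat \<Rightarrow> nat \<Rightarrow> nat \<Rightarrow> nat" where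
  "table T d W t = (let i = t div 2 div W; j = t div 2 mod W in
     if even t then max_occ T (i * d) (j * d) else next_block T d i j)"

definition fields :: "nat \<Rightarrow> nat \<Rightarrow> nat \<Rightarrow> nat list \<Rightarrow> (nat \<Rightarrow> nat) \<Rightarrow> (nat \<Rightarrow> nat) \<Rightarrow> nat list" where
  "fields k d W T idx A = [k, d, W, length T] @ map (\<lambda>p. length T + idx p) [0..<length T] @
     map A [0..<length T] @ map (table T d W) [0..<2 * (W * W)]"

lemma table_even: "j < W \<Longrightarrow> table T d W (2 * (i * W + j)) = max_occ T (i * d) (j * d)"
  and table_odd: "j < W \<Longrightarrow> table T d W (2 * (i * W + j) + 1) = next_block T d i j"
  by (simp_all add: table_def Let_def)

text \<open>Decoding succeeds because every value asked for is below 2 ^ k; the shifted ranks, below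
  2 * n, are the critical ones.\<close>

lemma mode_table_fields:
  fixes T :: "nat list"
  defines "n \<equiv> length T"
  assumes order: "occ_order T idx A" and d: "0 < d" "d \<le> n" and W: "W = n div d + 2"
    and k: "2 * n + 2 < 2 ^ k" and w: "2 * k + 1 \<le> w"
    and fit: "k + 1 + 4 * k + (3 * n + 2 * (W * W)) * k < 2 ^ w"
  shows "mode_table w T (encode k (fields k d W T idx A)) k (k + 1 + 4 * k) d W idx A"
proof -
  let ?xs = "fields k d W T idx A"
  have len: "length ?xs = 4 + (n + (n + 2 * (W * W)))" by (simp add: fields_def n_def)
  have fld: "data_word w (encode k ?xs) (k + 1 + 4 * k + q * k) mod 2 ^ k = x"
    if "q < 2 * n + 2 * (W * W)" "?xs ! (4 + q) = x" "x < 2 ^ k" for q x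
    using data_word_field[of "4 + q" ?xs k w] that len w by (simp add: add_mult_distrib add.assoc)
  have k0: "0 < k" using k by (cases k) auto
  have kw: "(2::nat) ^ k < 2 ^ w" using w k0 by (intro power_strict_increasing) auto
  have Wn: "W \<le> n + 2" by (simp add: W)
  have jd: "j * d \<le> n" if "j \<le> n div d" for j
    using mult_right_mono[OF that, of d] by (meson div_times_less_eq_dividend le_trans zero_le)
  have index: "i * W + j < W * W" if "i \<le> n div d + 1" "j \<le> n div d" for i j
    using mult_right_mono[OF that(1), of W] that(2) unfolding W by (simp add: algebra_simps)
  have at: "?xs ! (4 + (2 * n + t)) = table T d W t" if "t < 2 * (W * W)" for t
    using that by (simp add: fields_def nth_append n_def)
  show ?thesis
  proof
    show "data_word w (encode k ?xs) (k + 1 + 4 * k + p * k) mod 2 ^ k = length T + idx p"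
      if "p < length T" for p
    proof (rule fld)
      show "length T + idx p < 2 ^ k" using idx_less[OF order that] k that by (simp add: n_def)
    qed (use that in \<open>auto simp: fields_def nth_append n_def\<close>)
    show "data_word w (encode k ?xs) (k + 1 + 4 * k + (length T + q) * k) mod 2 ^ k = A q"
      if "q < length T" for q
    proof (rule fld)
      show "A q < 2 ^ k" using A_less[OF order that] k that by (simp add: n_def)
    qed (use that in \<open>auto simp: fields_def nth_append n_def\<close>)
    show "data_word w (encode k ?xs) (k + 1 + 4 * k + (2 * length T + 2 * (i * W + j)) * k) mod 2 ^ k =
        max_occ T (i * d) (j * d)"
      if "i \<le> length T div d + 1" "j \<le> length T div d" for i j
    proof (rule fld)
      have ij: "i * W + j < W * W" "j < W" using index that W by (simp_all add: n_def)
      then show "2 * length T + 2 * (i * W + j) < 2 * n + 2 * (W * W)" by (simp add: n_def)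
      show "?xs ! (4 + (2 * length T + 2 * (i * W + j))) = max_occ T (i * d) (j * d)"
        using at[of "2 * (i * W + j)"] ij table_even[of j W T d i] by (simp add: n_def)
      show "max_occ T (i * d) (j * d) < 2 ^ k"
        using max_occ_le[of T "i * d" "j * d"] jd[of j] that k by (simp add: n_def)
    qed
    show "data_word w (encode k ?xs) (k + 1 + 4 * k + (2 * length T + 2 * (i * W + j) + 1) * k) mod 2 ^ k =
        next_block T d i j"
      if "i < j" "j \<le> length T div d" for i j
    proof (rule fld)
      have ij: "i * W + j < W * W" "j < W" using index[of i j] that W by (simp_all add: n_def)
      then show "2 * length T + 2 * (i * W + j) + 1 < 2 * n + 2 * (W * W)" by (simp add: n_def)
      show "?xs ! (4 + (2 * length T + 2 * (i * W + j) + 1)) = next_block T d i j"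
        using at[of "2 * (i * W + j) + 1"] ij table_odd[of j W T d i] by (simp add: n_def add.assoc)
      have "next_block T d i j < j" using next_block(2)[OF d(1) that(1)] .
      also have "j \<le> j * d" using d(1) by simp
      also have "\<dots> \<le> n" using jd that by (simp add: n_def)
      finally show "next_block T d i j < 2 ^ k" using k by simp
    qed
    have "n + d \<le> (2 * n) * 1" using d(2) by simp
    also have "\<dots> \<le> (3 * n + 2 * (W * W)) * k" using k0 by (intro mult_le_mono) auto
    also have "\<dots> < 2 ^ w" using fit by (rule le_less_trans[OF le_add2])
    finally show "length T + d < 2 ^ w" by (simp add: n_def)
  qed (use order d W k0 kw fit in \<open>simp_all add: n_def\<close>)
qed

section \<open>Modes as characters of maximal count\<close>

text \<open>\<open>max_occ\<close> maximises over all numbers, not only over codes in the range. As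
  the maximum is positive, it is attained by a code that occurs there, and injectivity of the coding
  transfers the counts.\<close>

lemma modes_eq_occ:
  assumes inj: "inj_on \<phi> (set S)" and lr: "l \<le> r" "r < length S"
  shows "\<phi> ` range_modes S l r =
    {c. occ (map \<phi> S) c l (Suc r) = max_occ (map \<phi> S) l (Suc r)}" (is "_ = ?M")
proof -
  let ?T = "map \<phi> S"
  have set: "set_mset (range_mset S l r) = (!) S ` {l..r}" by (simp add: range_mset_def)
  have sub: "(!) S ` {l..r} \<subseteq> set S" using lr by auto
  have count: "count (range_mset S l r) x = occ ?T (\<phi> x) l (Suc r)" if "x \<in> set S" for x
  proof -
    have "count (range_mset S l r) x = card ((!) S -` {x} \<inter> {l..r})"
      by (simp add: range_mset_def count_image_mset)
    also have "(!) S -` {x} \<inter> {l..r} = {i \<in> {l..<Suc r}. ?T ! i = \<phi> x}"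
      using lr that inj by (auto simp: inj_on_eq_iff)
    finally show ?thesis by (simp add: occ_def)
  qed
  have pos: "0 < max_occ ?T l (Suc r)" using lr by (intro max_occ_pos) simp
  have in_range: "\<exists>x \<in> (!) S ` {l..r}. c = \<phi> x" if c: "0 < occ ?T c l (Suc r)" for c
  proof -
    obtain i where "l \<le> i" "i < Suc r" "?T ! i = c" using c by (rule occ_first)
    then show ?thesis using lr by force
  qed
  show ?thesis
  proof (intro equalityI subsetI)
    fix c assume "c \<in> \<phi> ` range_modes S l r"
    then obtain x where x: "c = \<phi> x" "x \<in> (!) S ` {l..r}"
      "\<And>y. count (range_mset S l r) y \<le> count (range_mset S l r) x"
      using set by (auto simp: range_modes_def modes_def)
    obtain c' where c': "occ ?T c' l (Suc r) = max_occ ?T l (Suc r)" using max_occ_attained by blast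
    then obtain y where "y \<in> (!) S ` {l..r}" "c' = \<phi> y" using in_range pos by metis
    then have "max_occ ?T l (Suc r) \<le> occ ?T c l (Suc r)"
      using count x c' sub by (metis subsetD)
    then show "c \<in> ?M" using occ_le_max_occ[of ?T c l "Suc r"] by simp
  next
    fix c assume c: "c \<in> ?M"
    then obtain x where x: "x \<in> (!) S ` {l..r}" "c = \<phi> x" using in_range pos by (metis mem_Collect_eq)
    have "count (range_mset S l r) y \<le> count (range_mset S l r) x" for y
    proof (cases "y \<in> set S")
      case True
      then show ?thesis using count[of y] count[of x] x c sub occ_le_max_occ[of ?T "\<phi> y" l "Suc r"] by auto
    next
      case False
      then have "count (range_mset S l r) y = 0" using set sub by (auto simp: count_eq_zero_iff)
      then show ?thesis by simp
    qed
    then have "x \<in> range_modes S l r" using x set by (simp add: range_modes_def modes_def)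
    then show "c \<in> \<phi> ` range_modes S l r" using x by blast
  qed
qed

lemma card_range_modes:
  assumes inj: "inj_on \<phi> (set S)" and lr: "l \<le> r" "r < length S"
  shows "card (\<phi> ` range_modes S l r) = card (range_modes S l r)"
proof (rule card_image)
  have "range_modes S l r \<subseteq> set S"
    using lr by (auto simp: range_modes_def modes_def range_mset_def)
  then show "inj_on \<phi> (range_modes S l r)" using inj inj_on_subset by blast
qed

section \<open>Choice of the parameters\<close>

text \<open>The number 2 * n + 2 bounds the shifted ranks as well as the row length, which is at
  most n + 2.\<close>

definition field_width :: "nat \<Rightarrow> nat" where
  "field_width n = nat \<lfloor>log 2 (real (2 * n + 2))\<rfloor> + 1"

lemma less_power_field_width: "2 * n + 2 < 2 ^ field_width n"
  and power_field_width_le: "2 ^ field_width n \<le> 2 * (2 * n + 2)"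
  and field_width_le: "real (field_width n) \<le> log 2 (real (2 * n + 2)) + 1"
proof -
  let ?x = "log 2 (real (2 * n + 2))"
  have x0: "0 \<le> ?x" by simp
  define m where "m = nat \<lfloor>?x\<rfloor>"
  have le: "real m \<le> ?x" using x0 by (simp add: m_def)
  have "?x < real (field_width n)" unfolding field_width_def using x0 by linarith
  then have "real (2 * n + 2) < 2 powr real (field_width n)" by (subst (asm) log_less_iff) auto
  then have "real (2 * n + 2) < real (2 ^ field_width n)" by (simp add: powr_realpow)
  then show "2 * n + 2 < 2 ^ field_width n" unfolding of_nat_less_iff .
  have "2 powr real m \<le> real (2 * n + 2)" using le by (subst (asm) le_log_iff) auto
  then have "real (2 ^ m) \<le> real (2 * n + 2)" by (simp add: powr_realpow)
  then have "2 ^ m \<le> 2 * n + 2" unfolding of_nat_le_iff .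
  then show "2 ^ field_width n \<le> 2 * (2 * n + 2)" unfolding field_width_def m_def by simp
  show "real (field_width n) \<le> ?x + 1" using le unfolding field_width_def m_def by simp
qed

text \<open>Origin of the factor 10: with \<open>N = n + 1\<close> the hypothesis gives
  \<open>N ^ 10 \<le> 2 ^ w\<close>. The largest address is at most cubic in \<open>N\<close>, with
  k crudely bounded by 4 * N, and since N \<ge> 2 the remaining seven factors absorb the constant
  128 = 2 ^ 7.\<close>

lemma word_length_sufficient:
  fixes n \<sigma> w d :: nat
  assumes adm: "admissible_word_length 10 n \<sigma> w" and n: "1 \<le> n"
  defines "k \<equiv> field_width n" and "W \<equiv> n div d + 2"
  shows "2 * k + 1 \<le> w" and "k + 1 + 4 * k + (3 * n + 2 * (W * W)) * k < 2 ^ w"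
proof -
  define N where "N = n + 1"
  have N: "2 \<le> N" using n by (simp add: N_def)
  have "real 10 * log 2 (real N) \<le> real 10 * log 2 (real (max n \<sigma>) + 1)"
    by (intro mult_left_mono) (auto simp: N_def)
  also have "\<dots> \<le> real w" using adm by (simp add: admissible_word_length_def)
  finally have "log 2 (real N ^ 10) \<le> real w" using N by (simp add: log_nat_power)
  then have "real N ^ 10 \<le> 2 powr real w" using N by (subst (asm) log_le_iff) auto
  then have "real (N ^ 10) \<le> real (2 ^ w)" by (simp add: powr_realpow)
  then have w: "N ^ 10 \<le> 2 ^ w" unfolding of_nat_le_iff .
  have pw: "x * N ^ a \<le> N ^ (a + b)" if "x \<le> 2 ^ b" for x a b
  proof -
    have "x \<le> N ^ b" using that power_mono[OF N, of b] by simp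
    then show ?thesis by (simp add: power_add mult.commute mult_le_mono2)
  qed
  have k: "2 ^ k \<le> 4 * N" using power_field_width_le[of n] by (simp add: k_def N_def)
  have "(2 :: nat) ^ (2 * k + 1) = 2 * (2 ^ k * 2 ^ k)" by (simp add: mult_2[of k] power_add)
  also have "\<dots> \<le> 2 * ((4 * N) * (4 * N))" using k by (intro mult_le_mono) auto
  also have "\<dots> = 32 * N ^ 2" by (simp add: power2_eq_square)
  also have "\<dots> \<le> N ^ (2 + 8)" by (rule pw) simp
  also have "\<dots> \<le> 2 ^ w" using w by simp
  finally show "2 * k + 1 \<le> w" by (rule power_le_imp_le_exp[rotated]) simp
  have kN: "k \<le> 4 * N" using k less_exp[of k] by linarith
  have "W \<le> n + 2" unfolding W_def by (intro add_right_mono div_le_dividend)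
  then have WN: "W \<le> 2 * N" by (simp add: N_def)
  have "N * 1 \<le> N * N" using N by (intro mult_le_mono) auto
  then have "N \<le> N ^ 2" by (simp add: power2_eq_square)
  have "N \<le> N ^ 3" using N by (intro self_le_power) auto
  note \<open>N \<le> N ^ 2\<close>
  moreover have "W * W \<le> (2 * N) * (2 * N)" using WN by (intro mult_le_mono)
  ultimately have "3 * n + 2 * (W * W) \<le> 11 * N ^ 2" by (simp add: power2_eq_square N_def)
  then have "(3 * n + 2 * (W * W)) * k \<le> (11 * N ^ 2) * (4 * N)" using kN by (intro mult_le_mono)
  then have "k + 1 + 4 * k + (3 * n + 2 * (W * W)) * k \<le> 21 * N + 44 * N ^ 3"
    using kN N by (simp add: power2_eq_square power3_eq_cube)
  also have "\<dots> < 128 * N ^ 3"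
    using \<open>N \<le> N ^ 3\<close> N by linarith
  also have "\<dots> \<le> N ^ (3 + 7)" by (rule pw) simp
  also have "\<dots> \<le> 2 ^ w" using w by simp
  finally show "k + 1 + 4 * k + (3 * n + 2 * (W * W)) * k < 2 ^ w" .
qed

text \<open>Rounding up at most doubles the length, as \<open>real n powr \<epsilon>\<close> is at
  least 1, and it can only decrease the number of blocks.\<close>

lemma block_length:
  fixes \<epsilon> :: real and n :: nat
  assumes eps: "0 \<le> \<epsilon>" "\<epsilon> \<le> 1 / 2" and n: "1 \<le> n"
  defines "d \<equiv> nat \<lceil>real n powr \<epsilon>\<rceil>"
  shows "0 < d" and "d \<le> n" and "real d \<le> 2 * real n powr \<epsilon>"
    and "real (n div d) \<le> real n powr (1 - \<epsilon>)"
proof -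
  have one: "1 \<le> real n powr \<epsilon>" using n eps by (intro ge_one_powr_ge_zero) auto
  then show d: "0 < d" unfolding d_def by linarith
  show "real d \<le> 2 * real n powr \<epsilon>" using one unfolding d_def by linarith
  have "real n powr \<epsilon> \<le> real n powr 1" using n eps by (intro powr_mono) auto
  then have "real n powr \<epsilon> \<le> real n" using n by simp
  then show "d \<le> n" by (simp add: d_def nat_le_iff ceiling_le_iff)
  have "real (n div d) \<le> real n / real d" by (rule of_nat_div_le_of_nat)
  also have "\<dots> \<le> real n / real n powr \<epsilon>"
    using d one by (intro divide_left_mono) (auto simp: d_def)
  also have "\<dots> = real n powr (1 - \<epsilon>)" using n by (simp add: powr_diff)
  finally show "real (n div d) \<le> real n powr (1 - \<epsilon>)" .
qed

theorem theorem13: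
  fixes \<epsilon> :: real
  assumes "0 \<le> \<epsilon>" and "\<epsilon> \<le> 1 / 2"
  shows "\<exists>(query :: com) (c :: nat) (space :: nat \<Rightarrow> real) (time :: nat \<Rightarrow> real).
    c \<ge> 1 \<and>
    space \<in> O(\<lambda>n. real n powr (2 - 2 * \<epsilon>) * log 2 (real n)) \<and>
    time \<in> O(\<lambda>n. real n powr \<epsilon>) \<and>
    (\<forall>(\<Sigma> :: 'a set) (\<phi> :: 'a \<Rightarrow> nat) (S :: 'a list).
       finite \<Sigma> \<longrightarrow> bij_betw \<phi> \<Sigma> {0..<card \<Sigma>} \<longrightarrow> set S \<subseteq> \<Sigma> \<longrightarrow>
       (\<exists>D :: bool list.
          real (length D) \<le> space (length S) \<and>
          (\<forall>w l r. admissible_word_length c (length S) (card \<Sigma>) w \<longrightarrow>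
             l \<le> r \<longrightarrow> r < length S \<longrightarrow>
             answers_query query w \<phi> S D l r
               (time (length S) * real (card (range_modes S l r))))))"
proof -
  define d where "d n = nat \<lceil>real n powr \<epsilon>\<rceil>" for n
  define W where "W n = n div d n + 2" for n
  define k where "k n = field_width n" for n
  define space where "space n = k n + 1 + (4 + 2 * n + 2 * (W n * W n)) * k n" for n
  have space: "(\<lambda>n. real (space n)) \<in> O(\<lambda>n. real n powr (2 - 2 * \<epsilon>) * log 2 (real n))"
  \<comment> \<open>With P for the power of n, 5 + 2 * n + 2 * W * W is at most 25 * P, the leading
    1 makes it 26, and k \<le> 4 * log n makes it 104. From n = 2 on the logarithm is at least
    1.\<close>
  proof (rule bigoI[of _ 110], rule eventually_sequentiallyI[of 2])
    fix n :: nat assume n: "2 \<le> n"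
    define P where "P = real n powr (2 - 2 * \<epsilon>)"
    define y where "y = real n powr (1 - \<epsilon>)"
    have yy: "y * y = P" using n by (simp add: y_def P_def flip: powr_add)
    have y1: "1 \<le> y" unfolding y_def using n assms by (intro ge_one_powr_ge_zero) auto
    \<comment> \<open>Here \<epsilon> \<le> 1/2 enters: the exponent 2 - 2 * \<epsilon> is at least
      1, so the fields for ranks and positions are absorbed.\<close>
    have "real n powr 1 \<le> P" unfolding P_def using n assms by (intro powr_mono) auto
    then have nP: "real n \<le> P" using n by simp
    have P1: "1 \<le> P" using nP n by linarith
    have "real (W n) \<le> 3 * y"
      using block_length(4)[OF assms, of n] n y1 by (simp add: W_def d_def y_def)
    then have "real (W n) * real (W n) \<le> (3 * y) * (3 * y)" by (intro mult_mono) auto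
    then have WW: "real (W n * W n) \<le> 9 * P" using yy by simp
    have lg: "1 \<le> log 2 (real n)" using n by simp
    have "real (k n) \<le> log 2 (real (2 * n + 2)) + 1" by (simp only: k_def field_width_le)
    also have "log 2 (real (2 * n + 2)) \<le> log 2 (4 * real n)" using n by (intro log_mono) auto
    also have "\<dots> = 2 + log 2 (real n)" using n log_nat_power[of 2 2 2] by (simp add: log_mult)
    finally have kl: "real (k n) \<le> 4 * log 2 (real n)" using lg by simp
    have k1: "1 \<le> real (k n)" by (simp add: k_def field_width_def)
    have "1 * 1 \<le> P * real (k n)" using P1 k1 by (intro mult_mono) auto
    have "real (space n) = 1 + (5 + 2 * real n + 2 * real (W n * W n)) * real (k n)"
      by (simp add: space_def algebra_simps)
    also have "\<dots> \<le> 1 + (25 * P) * real (k n)"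
      using P1 nP WW by (intro add_left_mono mult_right_mono) auto
    also have "\<dots> \<le> 26 * (P * real (k n))" using \<open>1 * 1 \<le> P * real (k n)\<close> by simp
    also have "\<dots> \<le> 26 * (P * (4 * log 2 (real n)))" using kl P1 by (intro mult_left_mono) auto
    also have "\<dots> \<le> 110 * (P * log 2 (real n))" using P1 lg by simp
    finally show "norm (real (space n)) \<le> 110 * norm (real n powr (2 - 2 * \<epsilon>) * log 2 (real n))"
      using lg by (simp add: P_def abs_mult)
  qed
  have time: "(\<lambda>n. real (400 * d n)) \<in> O(\<lambda>n. real n powr \<epsilon>)"
  proof (rule bigoI[of _ 800], rule eventually_sequentiallyI[of 1])
    fix n :: nat assume "1 \<le> n"
    then show "norm (real (400 * d n)) \<le> 800 * norm (real n powr \<epsilon>)"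
      using block_length(3)[OF assms, of n, folded d_def] by simp
  qed
  have main: "\<exists>D :: bool list. real (length D) \<le> real (space (length S)) \<and>
      (\<forall>w l r. admissible_word_length 10 (length S) (card \<Sigma>) w \<longrightarrow> l \<le> r \<longrightarrow> r < length S \<longrightarrow>
        answers_query mode_query w \<phi> S D l r
          (real (400 * d (length S)) * real (card (range_modes S l r))))"
    if bij: "bij_betw \<phi> \<Sigma> {0..<card \<Sigma>}" and S: "set S \<subseteq> \<Sigma>"
    for \<Sigma> :: "'a set" and \<phi> and S
  proof -
    define n T where "n = length S" and "T = map \<phi> S"
    have lenT: "length T = n" by (simp add: n_def T_def)
    have inj: "inj_on \<phi> (set S)" using bij S by (meson bij_betw_def inj_on_subset)
    obtain idx A where order: "occ_order T idx A" using occ_order_exists by blast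
    \<comment> \<open>The fields, and with them the bit string, are fixed before \<open>w\<close>,
      \<open>l\<close> and \<open>r\<close>: one bit string serves all admissible word
      lengths.\<close>
    let ?xs = "fields (k n) (d n) (W n) T idx A"
    show ?thesis
    proof (intro exI conjI allI impI)
      show "real (length (encode (k n) ?xs)) \<le> real (space (length S))"
        by (simp add: length_encode space_def fields_def lenT algebra_simps flip: n_def)
      fix w l r assume adm: "admissible_word_length 10 (length S) (card \<Sigma>) w"
        and lr: "l \<le> r" "r < length S"
      have n: "1 \<le> n" using lr by (simp add: n_def)
      have w: "2 * k n + 1 \<le> w" "k n + 1 + 4 * k n + (3 * n + 2 * (W n * W n)) * k n < 2 ^ w"
        using word_length_sufficient(1)[OF adm[folded n_def] n]
          word_length_sufficient(2)[OF adm[folded n_def] n, of "d n"] by (simp_all only: k_def W_def)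
      have dn: "0 < d n" "d n \<le> n" using block_length(1,2)[OF assms n] by (simp_all only: d_def)
      have k: "2 * n + 2 < 2 ^ k n" unfolding k_def by (rule less_power_field_width)
      interpret tab: mode_table w T "encode (k n) ?xs" "k n" "k n + 1 + 4 * k n" "d n" "W n" idx A
        "\<lambda>q. data_word w (encode (k n) ?xs) (k n + 1 + 4 * k n + q * k n) mod 2 ^ k n"
        by (rule mode_table_fields) (use order dn k w in \<open>simp_all add: lenT W_def\<close>)
      have xs: "?xs ! 0 = k n" "?xs ! 1 = d n" "?xs ! 2 = W n" "?xs ! 3 = n"
        by (simp_all add: fields_def lenT)
      have "?xs ! q < 2 ^ k n" if "q < 4" for q
      proof -
        have "W n \<le> n + 2" by (simp add: W_def)
        moreover have "k n < 2 ^ k n" by simp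
        moreover have "q = 0 \<or> q = 1 \<or> q = 2 \<or> q = 3" using that by auto
        ultimately show ?thesis using xs k dn by auto
      qed
      then have "runs w T (encode (k n) ?xs) init_header (query_state l r) 40 (\<lambda>s. emitted s = [] \<and>
          regs s 0 = l \<and> regs s 1 = r \<and> regs s 20 = 1 \<and> regs s 21 = k n \<and> regs s 22 = 2 ^ k n \<and>
          regs s 23 = k n + 1 + 4 * k n \<and> regs s 24 = d n \<and> regs s 25 = W n \<and>
          regs s 31 = length T \<and> regs s 32 = 0)"
        using runs_init_header[of "k n" w ?xs T l r] w tab.k_pos xs by (simp add: fields_def lenT)
      from tab.runs_mode_query[OF lr(1) _ this]
      have "runs w T (encode (k n) ?xs) mode_query (query_state l r)
          (400 * d n * card {c. occ T c l (Suc r) = max_occ T l (Suc r)})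
          (\<lambda>s. distinct (emitted s) \<and> set (emitted s) = {c. occ T c l (Suc r) = max_occ T l (Suc r)})"
        using lr by (simp add: T_def)
      then obtain u s where "exec w T (encode (k n) ?xs) mode_query (query_state l r) u s"
          "u \<le> 400 * d n * card (range_modes S l r)" "distinct (emitted s)"
          "set (emitted s) = \<phi> ` range_modes S l r"
        using modes_eq_occ[OF inj lr] card_range_modes[OF inj lr] unfolding runs_def T_def by metis
      moreover from this have "real u \<le> real (400 * d n) * real (card (range_modes S l r))"
        by (metis of_nat_le_iff of_nat_mult)
      ultimately show "answers_query mode_query w \<phi> S (encode (k n) ?xs) l r
          (real (400 * d (length S)) * real (card (range_modes S l r)))"
        unfolding answers_query_def T_def n_def by blast
    qed
  qed
  show ?thesis
    by (rule exI[of _ mode_query], rule exI[of _ 10], rule exI[of _ "\<lambda>n. real (space n)"],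
        rule exI[of _ "\<lambda>n. real (400 * d n)"], rule conjI, simp,
        intro conjI allI impI space time, rule main)
qed

end
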